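(* Let $h$ and $w$ be positive integers. For a partition $\lambda$ with length $\le 2h$ and $\lambda_1-\lambda_{2h}\le w$, define $$ c^{\pm}_{2h,w}(\lambda)=\begin{cases}1,&\text{if }\lambda_{2i-1}=\lambda_{2i}\text{ for all }1\le i\le h,\\ \pm1,&\text{if }\lambda_1-\lambda_{2h}=w\text{ and }\lambda_{2i}=\lambda_{2i+1}\text{ for all }1\le i\le h-1,\\ 0,&\text{otherwise.}\end{cases} $$ Then $$ \sum_{\lambda\in\mathrm{Par}(2h,w)}c^+_{2h,w}(\lambda)\,s_{\lambda[2h,w]'}(\mathbf x)=\det_{1\le i,j\le h}\left(\overline F_{-i+j,2h+w}(\mathbf x)-\overline F_{i+j,2h+w}(\mathbf x)\right), $$ $$ \sum_{\lambda\in\mathrm{Par}(2h,w)}c^-_{2h,w}(\lambda)\,s_{\lambda[2h,w]'}(\mathbf x)=\det_{1\le i,j\le h}\left(F_{-i+j,2h+w}(\mathbf x)-F_{i+j,2h+w}(\mathbf x)\right). $$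
   Context: $\mathbf x=\{x_1,x_2,\dots\}$ is a set of variables; identities are of formal power series. $e_n(\mathbf x)$ is the $n$-th elementary symmetric function ($e_0=1$, $e_n=0$ for $n<0$). For $r\in\mathbb Z$ and $N\ge1$: $f_r(\mathbf x)=\sum_{i\in\mathbb Z}e_i(\mathbf x)e_{i+r}(\mathbf x)$, $F_{r,N}(\mathbf x)=\sum_{k\in\mathbb Z}f_{r+Nk}(\mathbf x)$, $\overline F_{r,N}(\mathbf x)=\sum_{k\in\mathbb Z}(-1)^kf_{r+Nk}(\mathbf x)$. Partitions are written with $\lambda_i=0$ for $i>\ell(\lambda)$. $\mathrm{Par}(m,w)$ is the set of partitions $\lambda$ with $\ell(\lambda)\le m$ and $\lambda_1-\lambda_m\le w$. Young diagrams are sets of cells $(i,j)$ ($i$ = row, counted downwards; $j$ = column). A semistandard Young tableau (SSYT) is a filling with positive integers, weakly increasing along rows and strictly increasing down columns. A row-strict tableau (RST) is a filling strictly increasing along rows and weakly increasing down columns. An SSYT (resp. RST) $T$ of shape $\lambda$ with at most $m$ rows is $(m,w)$-cylindric if $T\cup(T+(m,-w))$ is an SSYT (resp. RST) of a valid skew shape, where $T+(m,-w)$ is $T$ shifted $m$ units down and $w$ units to the left. For $\lambda\in\mathrm{Par}(m,w)$, $\mathrm{CSSYT}(\lambda;m,w)$ (resp. $\mathrm{CRST}(\lambda;m,w)$) is the set of $(m,w)$-cylindric SSYTs (resp. RSTs) of shape $\lambda$. For a tableau $T$, $\mathbf x^T=\prod_i x_i^{\#\{i\text{'s in }T\}}$.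 Cylindric Schur functions: for $\lambda\in\mathrm{Par}(m,w)$, $\lambda[m,w]$ is the set of all cells $(i,j)+(km,-kw)$, $(i,j)\in\lambda$, $k\in\mathbb Z$, modulo translation by multiples of $(m,-w)$, and $s_{\lambda[m,w]}(\mathbf x)=\sum_{T\in\mathrm{CSSYT}(\lambda;m,w)}\mathbf x^T$. The transpose $\lambda[m,w]'$ is obtained by exchanging the two coordinates of all cells; it equals the cylindric shape $\mu[w,m]$, where $\mu$ is the partition consisting of the cells of the transposed periodic set lying in rows $1,\dots,w$. Thus $s_{\lambda[m,w]'}(\mathbf x)=\sum_{T\in\mathrm{CSSYT}(\mu;w,m)}\mathbf x^T$; equivalently, $s_{\lambda[m,w]'}(\mathbf x)=\sum_{T\in\mathrm{CRST}(\lambda;m,w)}\mathbf x^T$. *)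

theory Defs
  imports
    "HOL-Library.Multiset"
    "HOL-Library.FuncSet"
    "Jordan_Normal_Form.Determinant"
begin

section \<open>Formal power series in countably many variables\<close>

text \<open>
  A monomial \<open>x\<^sub>a x\<^sub>b \<dots>\<close> is the multiset of the indices of its variables, and a power series is
  the family of its coefficients.  The variables are \<open>x\<^sub>1, x\<^sub>2, \<dots>\<close>; the index \<open>0\<close> exists in the
  type but no series below involves it.
\<close>

typedef 'a mfps = "UNIV :: (nat multiset \<Rightarrow> 'a) set"
  morphisms coef Abs_mfps ..

setup_lifting type_definition_mfps

lemma mfps_eqI: "(\<And>M. coef f M = coef g M) \<Longrightarrow> f = g"
  by transfer auto

lemma finite_submultisets: "finite {A. A \<subseteq># (M :: 'b multiset)}"
proof (induction M)
  case (add x M)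
  have "{A. A \<subseteq># add_mset x M} \<subseteq> {A. A \<subseteq># M} \<union> add_mset x ` {A. A \<subseteq># M}"
  proof
    fix A assume "A \<in> {A. A \<subseteq># add_mset x M}"
    then have A: "A \<subseteq># add_mset x M" by simp
    show "A \<in> {A. A \<subseteq># M} \<union> add_mset x ` {A. A \<subseteq># M}"
    proof (cases "x \<in># A")
      case True
      then obtain B where "A = add_mset x B" by (metis insert_DiffM)
      with A show ?thesis by auto
    next
      case False
      with A have "A \<subseteq># M"
        by (metis add_mset_remove_trivial diff_single_trivial subset_eq_diff_conv union_single_eq_diff
            add_mset_add_single)
      then show ?thesis by auto
    qed
  qed
  then show ?case using add by (meson finite_UnI finite_imageI finite_subset)
qed simp

instantiation mfps :: (comm_ring_1) comm_ring_1
begin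

lift_definition zero_mfps :: "'a mfps" is "\<lambda>M. 0" .
lift_definition one_mfps :: "'a mfps" is "\<lambda>M. if M = {#} then 1 else 0" .
lift_definition plus_mfps :: "'a mfps \<Rightarrow> 'a mfps \<Rightarrow> 'a mfps" is "\<lambda>f g M. f M + g M" .
lift_definition minus_mfps :: "'a mfps \<Rightarrow> 'a mfps \<Rightarrow> 'a mfps" is "\<lambda>f g M. f M - g M" .
lift_definition uminus_mfps :: "'a mfps \<Rightarrow> 'a mfps" is "\<lambda>f M. - f M" .
lift_definition times_mfps :: "'a mfps \<Rightarrow> 'a mfps \<Rightarrow> 'a mfps"
  is "\<lambda>f g M. \<Sum>A | A \<subseteq># M. f A * g (M - A)" .

instance
proof
  fix a b c :: "'a mfps"
  show "a + b + c = a + (b + c)" by transfer (simp add: add.assoc)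
  show "a + b = b + a" by transfer (simp add: add.commute)
  show "0 + a = a" by transfer simp
  show "- a + a = 0" by transfer simp
  show "a - b = a + - b" by transfer simp
  show "(0 :: 'a mfps) \<noteq> 1" by transfer (auto simp: fun_eq_iff)
  show "(a + b) * c = a * c + b * c" by transfer (simp add: distrib_right sum.distrib)
  show "a * b = b * a"
  proof (transfer, rule ext)
    fix a b :: "nat multiset \<Rightarrow> 'a" and M
    show "(\<Sum>A | A \<subseteq># M. a A * b (M - A)) = (\<Sum>A | A \<subseteq># M. b A * a (M - A))"
      by (rule sum.reindex_bij_witness[of _ "\<lambda>A. M - A" "\<lambda>A. M - A"])
        (auto simp: mult.commute subset_mset.diff_diff_right)
  qed
  show "1 * a = a"
  proof (transfer, rule ext)
    fix a :: "nat multiset \<Rightarrow> 'a" and M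
    have "(\<Sum>A | A \<subseteq># M. (if A = {#} then 1 else 0) * a (M - A))
        = (\<Sum>A | A \<subseteq># M. if A = {#} then a M else 0)"
      by (rule sum.cong) auto
    also have "\<dots> = a M"
      using finite_submultisets[of M] by (simp add: sum.delta')
    finally show "(\<Sum>A | A \<subseteq># M. (if A = {#} then 1 else 0) * a (M - A)) = a M" .
  qed
  show "a * b * c = a * (b * c)"
  proof (transfer, rule ext)
    fix a b c :: "nat multiset \<Rightarrow> 'a" and M
    have sub: "B + (A - B) = A" "B \<subseteq># M" "A - B \<subseteq># M - B" "M - B - (A - B) = M - A"
      if "A \<subseteq># M" "B \<subseteq># A" for A B :: "nat multiset"
      using that by (auto simp: subseteq_mset_def multiset_eq_iff intro: order.trans diff_le_mono)
    have sub2: "B + C \<subseteq># M" if "B \<subseteq># M" "C \<subseteq># M - B" for B C :: "nat multiset"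
      unfolding subseteq_mset_def
    proof
      fix x
      have "count B x \<le> count M x" "count C x \<le> count M x - count B x"
        using that by (auto simp: subseteq_mset_def)
      then show "count (B + C) x \<le> count M x" by simp
    qed
    have "(\<Sum>A | A \<subseteq># M. (\<Sum>B | B \<subseteq># A. a B * b (A - B)) * c (M - A))
        = (\<Sum>(A, B) \<in> (SIGMA A:{A. A \<subseteq># M}. {B. B \<subseteq># A}). a B * b (A - B) * c (M - A))"
      by (simp add: sum_distrib_right sum.Sigma finite_submultisets)
    also have "\<dots> = (\<Sum>(B, C) \<in> (SIGMA B:{B. B \<subseteq># M}. {C. C \<subseteq># M - B}).
        a B * (b C * c (M - B - C)))"
      by (rule sum.reindex_bij_witness[of _ "\<lambda>(B, C). (B + C, B)" "\<lambda>(A, B). (B, A - B)"])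
        (auto simp: mult.assoc sub sub2)
    also have "\<dots> = (\<Sum>B | B \<subseteq># M. a B * (\<Sum>C | C \<subseteq># M - B. b C * c (M - B - C)))"
      by (simp add: sum_distrib_left sum.Sigma finite_submultisets)
    finally show "(\<Sum>A | A \<subseteq># M. (\<Sum>B | B \<subseteq># A. a B * b (A - B)) * c (M - A))
        = (\<Sum>B | B \<subseteq># M. a B * (\<Sum>C | C \<subseteq># M - B. b C * c (M - B - C)))" .
  qed
qed

end

definition var :: "nat \<Rightarrow> int mfps" where
  "var i = Abs_mfps (\<lambda>M. if M = {#i#} then 1 else 0)"

text \<open>
  A possibly infinite sum of power series, taken coefficientwise.  In all uses below a given monomial
  has a nonzero coefficient in only finitely many summands: \<open>f\<^sub>r\<close> has no terms of degree below \<open>|r|\<close>,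
  and in the other sums the summands are homogeneous and only finitely many of them contain a given
  monomial.
\<close>

definition mfps_sum :: "('b \<Rightarrow> int mfps) \<Rightarrow> 'b set \<Rightarrow> int mfps" where
  "mfps_sum f A = Abs_mfps (\<lambda>M. \<Sum>a | a \<in> A \<and> coef (f a) M \<noteq> 0. coef (f a) M)"

definition elem_sym :: "int \<Rightarrow> int mfps" where
  "elem_sym n = mfps_sum (\<lambda>S. \<Prod>i\<in>S. var i) {S. finite S \<and> S \<subseteq> {1..} \<and> int (card S) = n}"

definition f_series :: "int \<Rightarrow> int mfps" where
  "f_series r = mfps_sum (\<lambda>i. elem_sym i * elem_sym (i + r)) UNIV"

definition F_series :: "int \<Rightarrow> nat \<Rightarrow> int mfps" where
  "F_series r N = mfps_sum (\<lambda>k::int. f_series (r + int N * k)) UNIV"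

definition Fbar_series :: "int \<Rightarrow> nat \<Rightarrow> int mfps" where
  "Fbar_series r N =
     mfps_sum (\<lambda>k::int. (if even k then 1 else - 1) * f_series (r + int N * k)) UNIV"


section \<open>Partitions and cylindric tableaux\<close>

text \<open>A partition is the list of its nonzero parts, so its length \<open>\<ell>(\<lambda>)\<close> is the length of the list.\<close>

definition is_partition :: "nat list \<Rightarrow> bool" where
  "is_partition lam \<longleftrightarrow> sorted_wrt (\<ge>) lam \<and> 0 \<notin> set lam"

definition part :: "nat list \<Rightarrow> nat \<Rightarrow> nat" where
  "part lam i = (if 1 \<le> i \<and> i \<le> length lam then lam ! (i - 1) else 0)"

definition Par :: "nat \<Rightarrow> nat \<Rightarrow> nat list set" where
  "Par m w = {lam. is_partition lam \<and> length lam \<le> m \<and> int (part lam 1) - int (part lam m) \<le> int w}"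

type_synonym cell = "int \<times> int"

definition young :: "nat list \<Rightarrow> cell set" where
  "young lam = {(i, j). 1 \<le> i \<and> 1 \<le> j \<and> j \<le> int (part lam (nat i))}"

definition shift :: "int \<Rightarrow> int \<Rightarrow> cell set \<Rightarrow> cell set" where
  "shift a b D = (\<lambda>(i, j). (i + a, j + b)) ` D"

text \<open>Skew shapes are taken up to translation, because shifted tableaux have nonpositive columns.\<close>

definition is_skew_shape :: "cell set \<Rightarrow> bool" where
  "is_skew_shape D \<longleftrightarrow> (\<exists>alpha beta a b. is_partition alpha \<and> is_partition beta \<and>
     young beta \<subseteq> young alpha \<and> D = shift a b (young alpha - young beta))"

text \<open>Fillings are extensional functions, so that a tableau is determined by its entries.\<close>

definition is_SSYT :: "cell set \<Rightarrow> (cell \<Rightarrow> nat) \<Rightarrow> bool" where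
  "is_SSYT D T \<longleftrightarrow> T \<in> D \<rightarrow>\<^sub>E {1..} \<and>
     (\<forall>i j j'. (i, j) \<in> D \<and> (i, j') \<in> D \<and> j < j' \<longrightarrow> T (i, j) \<le> T (i, j')) \<and>
     (\<forall>i i' j. (i, j) \<in> D \<and> (i', j) \<in> D \<and> i < i' \<longrightarrow> T (i, j) < T (i', j))"

text \<open>
  The filling \<open>T \<union> (T + (m, -w))\<close> of \<open>D \<union> (D + (m, -w))\<close>; the two pieces are disjoint when \<open>D\<close> is a
  diagram with at most \<open>m\<close> rows.
\<close>

definition cyl_double :: "nat \<Rightarrow> nat \<Rightarrow> cell set \<Rightarrow> (cell \<Rightarrow> nat) \<Rightarrow> cell \<Rightarrow> nat" where
  "cyl_double m w D T = (\<lambda>(i, j).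
     if (i, j) \<in> D then T (i, j)
     else if (i - int m, j + int w) \<in> D then T (i - int m, j + int w)
     else undefined)"

definition CSSYT :: "nat list \<Rightarrow> nat \<Rightarrow> nat \<Rightarrow> (cell \<Rightarrow> nat) set" where
  "CSSYT lam m w = {T. is_SSYT (young lam) T \<and>
     (let D = young lam \<union> shift (int m) (- int w) (young lam)
      in is_skew_shape D \<and> is_SSYT D (cyl_double m w (young lam) T))}"

definition tab_weight :: "cell set \<Rightarrow> (cell \<Rightarrow> nat) \<Rightarrow> int mfps" where
  "tab_weight D T = (\<Prod>i \<in> T ` D. var i ^ card {c \<in> D. T c = i})"

definition cyl_schur :: "nat list \<Rightarrow> nat \<Rightarrow> nat \<Rightarrow> int mfps" where
  "cyl_schur lam m w = mfps_sum (tab_weight (young lam)) (CSSYT lam m w)"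

text \<open>The cylindric shape \<open>\<lambda>[m,w]\<close>, represented by its periodic set of cells.\<close>

definition cyl_shape :: "nat list \<Rightarrow> nat \<Rightarrow> nat \<Rightarrow> cell set" where
  "cyl_shape lam m w = (\<Union>k::int. shift (k * int m) (- k * int w) (young lam))"

text \<open>
  The partition \<open>\<mu>\<close> with \<open>\<lambda>[m,w]' = \<mu>[w,m]\<close>, cut out of the transposed shape by the rows \<open>1, \<dots>, w\<close>.
  It exists and is unique for \<open>\<lambda> \<in> Par m w\<close>, see \<open>cyl_transpose_ex1\<close>.
\<close>

definition cyl_transpose :: "nat list \<Rightarrow> nat \<Rightarrow> nat \<Rightarrow> nat list" where
  "cyl_transpose lam m w = (THE mu. is_partition mu \<and>
     young mu = {(i, j) \<in> prod.swap ` cyl_shape lam m w. 1 \<le> i \<and> i \<le> int w})"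

definition cyl_schur_transpose :: "nat list \<Rightarrow> nat \<Rightarrow> nat \<Rightarrow> int mfps" where
  "cyl_schur_transpose lam m w = cyl_schur (cyl_transpose lam m w) w m"

text \<open>The coefficient \<open>c\<^sup>\<plusminus>\<^sub>2\<^sub>h\<^sub>,\<^sub>w(\<lambda>)\<close>, with \<open>\<epsilon> = \<plusminus>1\<close> as the value of the second case.\<close>

definition c_coeff :: "int \<Rightarrow> nat \<Rightarrow> nat \<Rightarrow> nat list \<Rightarrow> int" where
  "c_coeff \<epsilon> h w lam =
     (if \<forall>i. 1 \<le> i \<and> i \<le> h \<longrightarrow> part lam (2 * i - 1) = part lam (2 * i) then 1
      else if int (part lam 1) - int (part lam (2 * h)) = int w \<and>
        (\<forall>i. 1 \<le> i \<and> i \<le> h - 1 \<longrightarrow> part lam (2 * i) = part lam (2 * i + 1)) then \<epsilon>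
      else 0)"


section \<open>Existence of the transposed partition\<close>

lemma part_antimono:
  assumes "is_partition lam" "1 \<le> i" "i \<le> j"
  shows "part lam j \<le> part lam i"
proof (cases "i < j \<and> j \<le> length lam")
  case True
  then have "lam ! (i - 1) \<ge> lam ! (j - 1)"
    using assms sorted_wrt_nth_less[of "(\<ge>)" lam "i - 1" "j - 1"]
    by (auto simp: is_partition_def)
  then show ?thesis using True assms by (auto simp: part_def)
next
  case False
  then show ?thesis using assms by (auto simp: part_def)
qed

lemma part_pos_iff:
  assumes "is_partition lam"
  shows "part lam i > 0 \<longleftrightarrow> 1 \<le> i \<and> i \<le> length lam"
proof (cases "1 \<le> i \<and> i \<le> length lam")
  case True
  then have "lam ! (i - 1) \<in> set lam" by (intro nth_mem) auto
  then have "lam ! (i - 1) \<noteq> 0" using assms unfolding is_partition_def by metis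
  then show ?thesis using True by (simp add: part_def)
qed (auto simp: part_def)

lemma young_row_card: "1 \<le> i \<Longrightarrow> card {j. (int i, j) \<in> young lam} = part lam i"
proof -
  assume "1 \<le> i"
  then have "{j. (int i, j) \<in> young lam} = {1..int (part lam i)}" by (auto simp: young_def)
  then show ?thesis by simp
qed

lemma young_inj:
  assumes "is_partition mu" "is_partition nu" "young mu = young nu"
  shows "mu = nu"
proof -
  have eq: "part mu i = part nu i" for i
    using young_row_card[of i mu] young_row_card[of i nu] assms(3)
    by (cases "1 \<le> i") (auto simp: part_def)
  have iff: "i \<le> length mu \<longleftrightarrow> i \<le> length nu" if "1 \<le> i" for i
    using part_pos_iff[OF assms(1), of i] part_pos_iff[OF assms(2), of i] eq[of i] that by simp
  have len: "length mu = length nu"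
    using iff[of "length mu"] iff[of "length nu"] by linarith
  show ?thesis
  proof (rule nth_equalityI[OF len])
    fix i assume "i < length mu"
    then show "mu ! i = nu ! i" using eq[of "Suc i"] len by (simp add: part_def)
  qed
qed

lemma down_closed_int:
  assumes "finite (A :: int set)" "\<And>x. x \<in> A \<Longrightarrow> 1 \<le> x" "\<And>x y. x \<in> A \<Longrightarrow> 1 \<le> y \<Longrightarrow> y \<le> x \<Longrightarrow> y \<in> A"
  shows "A = {1..int (card A)}"
proof (cases "A = {}")
  case False
  define x where "x = Max A"
  have x: "x \<in> A" unfolding x_def using assms(1) False by (rule Max_in)
  have "A \<subseteq> {1..x}" using assms(2) Max_ge[OF assms(1)] by (auto simp: x_def)
  moreover have "{1..x} \<subseteq> A" using assms(3)[OF x] by auto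
  ultimately have A: "A = {1..x}" by blast
  then have "card A = nat x" by simp
  moreover have "1 \<le> x" using assms(2)[OF x] .
  ultimately show ?thesis using A by simp
qed simp

lemma down_closed_young:
  assumes fin: "finite S" and pos: "\<And>i j. (i, j) \<in> S \<Longrightarrow> 1 \<le> i \<and> 1 \<le> j"
    and down: "\<And>i j i' j'. (i, j) \<in> S \<Longrightarrow> 1 \<le> i' \<Longrightarrow> i' \<le> i \<Longrightarrow> 1 \<le> j' \<Longrightarrow> j' \<le> j \<Longrightarrow> (i', j') \<in> S"
  shows "\<exists>mu. is_partition mu \<and> young mu = (S :: cell set)"
proof -
  define r where "r i = card {j. (int i, j) \<in> S}" for i
  define n where "n = card {i. (i, 1) \<in> S}"
  have finr: "finite {j. (i, j) \<in> S}" for i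
    by (rule finite_subset[OF _ finite_imageI[OF fin, of snd]]) force
  have row: "{j. (int i, j) \<in> S} = {1..int (r i)}" for i
    unfolding r_def using down_closed_int[OF finr[of "int i"]] pos down by blast
  have "finite {i. (i, 1) \<in> S}"
    by (rule finite_subset[OF _ finite_imageI[OF fin, of fst]]) force
  then have col: "{i. (i, 1) \<in> S} = {1..int n}"
    unfolding n_def using down_closed_int[of "{i. (i, 1) \<in> S}"] pos down by blast
  have rpos: "r i > 0 \<longleftrightarrow> 1 \<le> i \<and> i \<le> n" for i
  proof -
    have "r i > 0 \<longleftrightarrow> 1 \<in> {j. (int i, j) \<in> S}" unfolding row by auto
    also have "\<dots> \<longleftrightarrow> int i \<in> {i. (i, 1) \<in> S}" by simp
    also have "\<dots> \<longleftrightarrow> 1 \<le> i \<and> i \<le> n" unfolding col by auto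
    finally show ?thesis .
  qed
  have anti: "r j \<le> r i" if "1 \<le> i" "i \<le> j" for i j
    unfolding r_def
  proof (rule card_mono[OF finr], rule subsetI)
    fix x assume "x \<in> {x. (int j, x) \<in> S}"
    then have "(int j, x) \<in> S" by simp
    from down[OF this, of "int i" x] pos[OF this] that show "x \<in> {x. (int i, x) \<in> S}" by simp
  qed
  define mu where "mu = map r [1..<Suc n]"
  have nth: "mu ! k = r (Suc k)" if "k < n" for k
    unfolding mu_def using that by (simp del: upt_Suc)
  have len: "length mu = n" unfolding mu_def by simp
  have part: "part mu i = r i" if "1 \<le> i" for i
    using that rpos[of i] nth[of "i - 1"] by (auto simp: part_def len)
  have "is_partition mu"
    unfolding is_partition_def sorted_wrt_iff_nth_less
  proof (intro conjI allI impI notI)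
    fix i j assume "i < j" "j < length mu"
    then show "mu ! j \<le> mu ! i" using anti[of "Suc i" "Suc j"] by (simp add: nth len)
  next
    assume "0 \<in> set mu"
    then obtain k where "k < n" "mu ! k = 0" by (metis in_set_conv_nth len)
    then show False using rpos[of "Suc k"] nth[of k] by simp
  qed
  moreover have "(i, j) \<in> young mu \<longleftrightarrow> (i, j) \<in> S" for i j
  proof (cases "1 \<le> i")
    case True
    then have "(i, j) \<in> S \<longleftrightarrow> j \<in> {1..int (r (nat i))}" using row[of "nat i"] by auto
    then show ?thesis using True part[of "nat i"] by (auto simp: young_def)
  next
    case False
    then show ?thesis using pos by (auto simp: young_def)
  qed
  ultimately show ?thesis by auto
qed

lemma mem_shift: "(i, j) \<in> shift a b D \<longleftrightarrow> (i - a, j - b) \<in> D"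
proof
  assume "(i - a, j - b) \<in> D"
  then show "(i, j) \<in> shift a b D"
    unfolding shift_def by (intro image_eqI[of _ _ "(i - a, j - b)"]) auto
qed (auto simp: shift_def)

lemma finite_young: "finite (young lam)"
proof -
  have "young lam \<subseteq> (\<Union>i\<in>{1..int (length lam)}. {i} \<times> {1..int (part lam (nat i))})"
    by (auto simp: young_def part_def split: if_splits)
  then show ?thesis by (rule finite_subset) simp
qed

lemma young_down:
  assumes "is_partition lam" "(i, j) \<in> young lam" "1 \<le> i'" "i' \<le> i" "1 \<le> j'" "j' \<le> j"
  shows "(i', j') \<in> young lam"
proof -
  have "part lam (nat i) \<le> part lam (nat i')"
    using assms by (intro part_antimono) auto
  then show ?thesis using assms by (auto simp: young_def)
qed

lemma cyl_transpose_ex1: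
  assumes lam: "lam \<in> Par m w" and "m > 0" "w > 0"
  shows "\<exists>!mu. is_partition mu \<and>
     young mu = {(i, j) \<in> prod.swap ` cyl_shape lam m w. 1 \<le> i \<and> i \<le> int w}"
    (is "\<exists>!mu. _ \<and> _ = ?S")
proof -
  have p: "is_partition lam" and len: "length lam \<le> m"
    and lw: "int (part lam 1) \<le> int (part lam m) + int w"
    using lam by (auto simp: Par_def)
  define S where "S = ?S"
  have mem: "(i, j) \<in> S \<longleftrightarrow>
      1 \<le> i \<and> i \<le> int w \<and> (\<exists>k. (j - k * int m, i + k * int w) \<in> young lam)" for i j
  proof -
    have "(j, i) \<in> cyl_shape lam m w \<longleftrightarrow> (\<exists>k. (j - k * int m, i + k * int w) \<in> young lam)"
      by (simp add: cyl_shape_def mem_shift)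
    moreover have "(i, j) \<in> prod.swap ` cyl_shape lam m w \<longleftrightarrow> (j, i) \<in> cyl_shape lam m w"
      by force
    ultimately show ?thesis by (auto simp: S_def)
  qed
  have memI: "(i, j) \<in> S"
    if "1 \<le> i" "i \<le> int w" "(j - k * int m, i + k * int w) \<in> young lam" for i j k
    using that unfolding mem by blast
  have memE: thesis
    if "(i, j) \<in> S"
      and "\<And>k. 1 \<le> i \<Longrightarrow> i \<le> int w \<Longrightarrow> (j - k * int m, i + k * int w) \<in> young lam \<Longrightarrow> thesis"
    for i j thesis
    using that unfolding mem by blast
  have k0: "0 \<le> k" if "(a, i + k * int w) \<in> young lam" "i \<le> int w" for a i k
  proof (rule ccontr)
    assume "\<not> 0 \<le> k"
    then have "k * int w \<le> (-1) * int w" by (intro mult_right_mono) auto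
    then show False using that by (auto simp: young_def)
  qed
  have fin: "finite S"
  proof -
    let ?g = "\<lambda>((a, b), k). (b - k * int w, a + k * int m)"
    have "S \<subseteq> ?g ` (young lam \<times> {0..int (part lam 1)})"
    proof
      fix x assume "x \<in> S"
      obtain i j where ij: "x = (i, j)" by (cases x)
      with \<open>x \<in> S\<close> obtain k where x: "x = (i, j)" "1 \<le> i" "i \<le> int w"
        and y: "(j - k * int m, i + k * int w) \<in> young lam"
        using memE by blast
      have k: "0 \<le> k" using k0[OF y x(3)] .
      have "(1, i + k * int w) \<in> young lam"
        by (rule young_down[OF p y]) (use y in \<open>auto simp: young_def\<close>)
      then have "i + k * int w \<le> int (part lam 1)" by (auto simp: young_def)
      moreover have "k * 1 \<le> k * int w" using k \<open>w > 0\<close> by (intro mult_left_mono) auto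
      ultimately have "k \<le> int (part lam 1)" using x by simp
      then show "x \<in> ?g ` (young lam \<times> {0..int (part lam 1)})"
        using y k x by (intro image_eqI[of _ _ "((j - k * int m, i + k * int w), k)"]) auto
    qed
    then show ?thesis by (rule finite_subset) (simp add: finite_young)
  qed
  have pos: "1 \<le> i \<and> 1 \<le> j" if "(i, j) \<in> S" for i j
  proof -
    from that obtain k where i: "1 \<le> i" "i \<le> int w"
      and y: "(j - k * int m, i + k * int w) \<in> young lam"
      by (rule memE)
    have "0 \<le> k * int m" using k0[OF y i(2)] by simp
    moreover have "1 \<le> j - k * int m" using y by (auto simp: young_def)
    ultimately show ?thesis using i by linarith
  qed
  have left: "(i, j - 1) \<in> S" if "(i, j) \<in> S" "1 < j" for i j
  proof -
    from that(1) obtain k where i: "1 \<le> i" "i \<le> int w"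
      and y: "(j - k * int m, i + k * int w) \<in> young lam"
      by (rule memE)
    have k: "0 \<le> k" using k0[OF y i(2)] .
    show ?thesis
    proof (cases "1 < j - k * int m")
      case True
      have "(j - 1 - k * int m, i + k * int w) \<in> young lam"
        by (rule young_down[OF p y]) (use True y in \<open>auto simp: young_def\<close>)
      then show ?thesis by (rule memI[OF i])
    next
      case False
      then have j: "j - k * int m = 1" using y by (auto simp: young_def)
      then have "k \<noteq> 0" using that(2) by auto
      then have k1: "1 \<le> k" using k by simp
      have "i + k * int w \<le> int (part lam 1)" using y j by (auto simp: young_def)
      then have "i + (k - 1) * int w \<le> int (part lam m)" using lw by (simp add: algebra_simps)
      moreover have "0 \<le> (k - 1) * int w" using k1 by simp
      ultimately have "(int m, i + (k - 1) * int w) \<in> young lam"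
        using i \<open>m > 0\<close> by (auto simp: young_def)
      moreover have "j - 1 - (k - 1) * int m = int m" using j by (simp add: algebra_simps)
      ultimately show ?thesis using memI[OF i, of "j - 1" "k - 1"] by simp
    qed
  qed
  have left': "(i, j - int d) \<in> S" if "(i, j) \<in> S" "int d < j" for i j d
    using that(2)
  proof (induction d)
    case (Suc d)
    then have "(i, j - int d - 1) \<in> S" by (intro left) auto
    then show ?case by (simp add: algebra_simps)
  qed (use that in simp)
  have up: "(i', j) \<in> S" if "(i, j) \<in> S" "1 \<le> i'" "i' \<le> i" for i j i'
  proof -
    from that(1) obtain k where i: "1 \<le> i" "i \<le> int w"
      and y: "(j - k * int m, i + k * int w) \<in> young lam"
      by (rule memE)
    have "0 \<le> k * int w" using k0[OF y i(2)] by simp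
    then have "(j - k * int m, i' + k * int w) \<in> young lam"
      by (intro young_down[OF p y]) (use that y in \<open>auto simp: young_def\<close>)
    then show ?thesis using that i by (intro memI) auto
  qed
  have "\<exists>mu. is_partition mu \<and> young mu = S"
  proof (rule down_closed_young[OF fin pos])
    fix i j i' j' assume S: "(i, j) \<in> S" and *: "1 \<le> i'" "i' \<le> i" "1 \<le> j'" "j' \<le> j"
    have "(i', j - int (nat (j - j'))) \<in> S"
      by (rule left'[OF up[OF S *(1,2)]]) (use * in auto)
    then show "(i', j') \<in> S" using * by simp
  qed auto
  then show ?thesis using young_inj unfolding S_def by (intro ex_ex1I) auto
qed

end

theory Submission
  imports Defs
begin

text \<open>
  Put \<open>m = 2h\<close> and \<open>N = 2h + w\<close>.  A cylindric row-strict tableau of shape \<open>\<lambda>\<close> records how \<open>m\<close>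
  particles travel from \<open>m - 1, \<dots>, 1, 0\<close> to \<open>\<lambda>\<^sub>j + m - j\<close>: an entry \<open>i\<close> in row \<open>j\<close> says that
  particle \<open>j\<close> makes a unit step at time \<open>i\<close>.  The tableau conditions say that at every time the
  positions satisfy \<open>p\<^sub>1 > \<dots> > p\<^sub>m > p\<^sub>1 - N\<close>, that is, the particles never collide on the circle of
  circumference \<open>N\<close>.

  The coefficient \<open>c\<^sup>\<plusminus>(\<lambda>)\<close> is nonzero exactly when the final positions are tiled by dimers, pairs of
  neighbours on the circle, and it is \<open>\<plusminus>1\<close> when one dimer crosses the seam between the last and the
  first particle.  This makes it the Pfaffian \<open>Pf(g\<^sub>0(p\<^sub>i, p\<^sub>j))\<close> of the antisymmetric adjacency kernel
  \<open>g\<^sub>0\<close> of the circle (\<open>pfaff_initial\<close>).  A Pfaffian is additive in every argument, so letting each particle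
  independently stay or step with weight \<open>x\<close> turns the Pfaffian of a kernel \<open>g\<close> into the
  Pfaffian of the kernel \<open>g(a, b) + x g(a, b + 1) + x g(a + 1, b) + x\<^sup>2 g(a + 1, b + 1)\<close>.  It is
  alternating, and \<open>g\<close> is periodic in \<open>N\<close> up to a sign, so it vanishes on the configurations in which
  two particles have just collided; hence forbidding them does not change the sum
  (\<open>path_sum_pfaff\<close>).  This is the reflection principle with a Pfaffian in place of a sum over the
  affine Weyl group.

  Starting from \<open>g\<^sub>0\<close>, one step for every variable produces the kernel
  \<open>g(a, b) = F\<^sub>a\<^sub>-\<^sub>b\<^sub>-\<^sub>1 - F\<^sub>a\<^sub>-\<^sub>b\<^sub>+\<^sub>1\<close>, where \<open>F\<close> is one of the two given families.  So the left-hand side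
  is the Toeplitz Pfaffian of size \<open>2h\<close> of \<open>g\<close>.  Its
  arguments \<open>0, \<dots>, 2h - 1\<close> are permuted by the reflection \<open>a \<mapsto> 2h - 1 - a\<close>, under which \<open>g\<close> is odd;
  the reflection-invariant combinations are therefore isotropic, and a Pfaffian with \<open>h\<close> isotropic
  arguments out of \<open>2h\<close> is a determinant of size \<open>h\<close> (\<open>pfaff_toeplitz\<close>).

  Since the coefficient of a monomial involves finitely many variables, everything is computed after setting
  all but finitely many variables to zero, which is a ring homomorphism.
\<close>

section \<open>Coefficients of power series\<close>

lemma coef_simps [simp]:
  "coef 0 M = 0" "coef 1 M = (if M = {#} then 1 else 0)" "coef (f + g) M = coef f M + coef g M"
  "coef (f - g) M = coef f M - coef g M" "coef (- f) M = - coef f M"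
  by (simp_all add: zero_mfps.rep_eq one_mfps.rep_eq plus_mfps.rep_eq minus_mfps.rep_eq uminus_mfps.rep_eq)

lemma coef_times: "coef (f * g) M = (\<Sum>A | A \<subseteq># M. coef f A * coef g (M - A))"
  by (simp add: times_mfps.rep_eq)

lemma coef_Abs [simp]: "coef (Abs_mfps f) = f"
  by (simp add: Abs_mfps_inverse)

lemma coef_sum: "coef (sum f A) M = (\<Sum>a\<in>A. coef (f a) M)"
  by (induction A rule: infinite_finite_induct) auto

lemma coef_of_int_times: "coef (of_int c * f) M = c * coef f M"
proof (induction c rule: int_of_nat_induct)
  case (nonneg n)
  show ?case by (induction n) (simp_all add: algebra_simps)
next
  case (neg n)
  have "coef (of_nat n * f) M = int n * coef f M" by (induction n) (simp_all add: algebra_simps)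
  then show ?case by (simp add: algebra_simps)
qed

lemma coef_mfps_sum: "coef (mfps_sum f A) M = (\<Sum>a | a \<in> A \<and> coef (f a) M \<noteq> 0. coef (f a) M)"
  by (simp add: mfps_sum_def)

lemma coef_var_times: "coef (var i * f) M = (if i \<in># M then coef f (M - {#i#}) else 0)"
proof -
  have "coef (var i * f) M = (\<Sum>A | A \<subseteq># M. if A = {#i#} then coef f (M - {#i#}) else 0)"
    unfolding coef_times var_def by (intro sum.cong) auto
  then show ?thesis using finite_submultisets[of M] by (simp add: sum.delta)
qed

lemma coef_monomial: "coef (\<Prod>i\<in>#X. var i) M = (if M = X then 1 else 0)"
proof (induction X arbitrary: M)
  case (add i X)
  then show ?case by (auto simp: coef_var_times)
qed simp

text \<open>
  Lets antisymmetry \<open>P = - P\<close> under an exchange of equal arguments give \<open>P = 0\<close>.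
\<close>

lemma mfps_no_2_torsion: "f = - f \<Longrightarrow> f = (0 :: int mfps)"
proof (rule mfps_eqI)
  fix M assume "f = - f"
  then have "coef f M = - coef f M" by (metis coef_simps(5))
  then show "coef f M = coef 0 M" by simp
qed

text \<open>
  Every coefficient of an infinite sum of series is computed in this way: the nonzero terms \<open>c a\<close> count
  the elements of a finite set \<open>Q\<close> of combinatorial objects, sorted by a statistic \<open>key\<close>, so that the
  sum over \<open>a\<close> is a sum over \<open>Q\<close>.
\<close>

lemma sum_over_fibres:
  fixes c :: "'b \<Rightarrow> int"
  assumes Q: "finite Q"
    and c: "\<And>a. a \<in> I \<Longrightarrow> c a = (\<Sum>q\<in>Q. if key q = a then v q else 0)"
  shows "(\<Sum>a | a \<in> I \<and> c a \<noteq> 0. c a) = (\<Sum>q\<in>{q \<in> Q. key q \<in> I}. v q)"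
proof -
  let ?Q = "{q \<in> Q. key q \<in> I}"
  have c': "c a = (\<Sum>q | q \<in> ?Q \<and> key q = a. v q)" if "a \<in> I" for a
  proof -
    have "c a = (\<Sum>q\<in>{q \<in> Q. key q = a}. v q)"
      unfolding c[OF that] using Q by (simp add: sum.If_cases Int_def)
    also have "{q \<in> Q. key q = a} = {q. q \<in> ?Q \<and> key q = a}" using that by auto
    finally show ?thesis .
  qed
  have "(\<Sum>a | a \<in> I \<and> c a \<noteq> 0. c a) = (\<Sum>a\<in>key ` ?Q. c a)"
  proof (rule sum.mono_neutral_left)
    show "{a. a \<in> I \<and> c a \<noteq> 0} \<subseteq> key ` ?Q"
    proof safe
      fix a assume "a \<in> I" "c a \<noteq> 0"
      then have "{q. q \<in> ?Q \<and> key q = a} \<noteq> {}" using c' by (metis sum.empty)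
      then show "a \<in> key ` ?Q" by auto
    qed
  qed (use Q in auto)
  also have "\<dots> = (\<Sum>a\<in>key ` ?Q. \<Sum>q | q \<in> ?Q \<and> key q = a. v q)"
    by (intro sum.cong refl c') auto
  also have "\<dots> = (\<Sum>q\<in>?Q. v q)"
    by (rule sum.group) (use Q in auto)
  finally show ?thesis .
qed

definition restrict_vars :: "nat set \<Rightarrow> int mfps \<Rightarrow> int mfps" where
  "restrict_vars X f = Abs_mfps (\<lambda>M. if set_mset M \<subseteq> X then coef f M else 0)"

lemma coef_restrict_vars: "coef (restrict_vars X f) M = (if set_mset M \<subseteq> X then coef f M else 0)"
  by (simp add: restrict_vars_def)

text \<open>
  Setting variables to zero is multiplicative because a product of two monomials involves only the
  variables in \<open>X\<close> if and only if both factors do.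
\<close>

lemma restrict_vars_hom: "comm_ring_hom (restrict_vars X)"
proof
  show "restrict_vars X (f * g) = restrict_vars X f * restrict_vars X g" for f g
  proof (rule mfps_eqI)
    fix M :: "nat multiset"
    show "coef (restrict_vars X (f * g)) M = coef (restrict_vars X f * restrict_vars X g) M"
    proof (cases "set_mset M \<subseteq> X")
      case True
      then have "set_mset A \<subseteq> X" "set_mset (M - A) \<subseteq> X" if "A \<subseteq># M" for A
        using that by (auto dest: mset_subset_eqD in_diffD)
      then show ?thesis using True by (simp add: coef_restrict_vars coef_times)
    next
      case False
      have "coef (restrict_vars X f) A * coef (restrict_vars X g) (M - A) = 0" if "A \<subseteq># M" for A
      proof -
        have "set_mset M = set_mset A \<union> set_mset (M - A)"
          using that by (metis set_mset_union subset_mset.add_diff_inverse)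
        then show ?thesis using False by (auto simp: coef_restrict_vars)
      qed
      then have "coef (restrict_vars X f * restrict_vars X g) M = 0"
        unfolding coef_times by (intro sum.neutral) simp
      then show ?thesis using False by (simp add: coef_restrict_vars)
    qed
  qed
qed (rule mfps_eqI, simp add: coef_restrict_vars)+


section \<open>Pfaffians\<close>

text \<open>
  Contraction by \<open>\<phi>\<close>: for alternating \<open>F\<close>, the list stands for the wedge product of its elements.  One element is removed in all possible ways, with alternating signs.
\<close>

primrec contract :: "('a \<Rightarrow> 'r) \<Rightarrow> ('a list \<Rightarrow> 'r) \<Rightarrow> 'a list \<Rightarrow> 'r :: comm_ring_1" where
  "contract \<phi> F [] = 0"
| "contract \<phi> F (x # xs) = \<phi> x * F xs - contract \<phi> (\<lambda>l. F (x # l)) xs"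

text \<open>
  Expansion of the Pfaffian along its first row, for \<open>n\<close> pairs.  Counting pairs by \<open>n\<close> makes the
  recursion primitive, and the value is \<open>0\<close> unless the list has length \<open>2 n\<close>.
\<close>

primrec pfaff :: "('a \<Rightarrow> 'a \<Rightarrow> 'r :: comm_ring_1) \<Rightarrow> nat \<Rightarrow> 'a list \<Rightarrow> 'r" where
  "pfaff B 0 xs = (if xs = [] then 1 else 0)"
| "pfaff B (Suc n) xs = (case xs of [] \<Rightarrow> 0 | x # ys \<Rightarrow> contract (B x) (pfaff B n) ys)"

lemma contract_add: "contract \<phi> (\<lambda>l. F l + G l) xs = contract \<phi> F xs + contract \<phi> G xs"
  by (induction xs arbitrary: F G) (simp_all add: algebra_simps)

lemma contract_scale: "contract \<phi> (\<lambda>l. c * F l) xs = c * contract \<phi> F xs"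
  by (induction xs arbitrary: F) (simp_all add: algebra_simps)

lemma contract_minus: "contract \<phi> (\<lambda>l. - F l) xs = - contract \<phi> F xs"
  using contract_scale[of \<phi> "- 1" F xs] by simp

lemma contract_diff: "contract \<phi> (\<lambda>l. F l - G l) xs = contract \<phi> F xs - contract \<phi> G xs"
  using contract_add[of \<phi> F "\<lambda>l. - G l"] by (simp add: contract_minus)

lemma contract_add_left:
  "contract (\<lambda>x. \<phi> x + c * \<psi> x) F xs = contract \<phi> F xs + c * contract \<psi> F xs"
  by (induction xs arbitrary: F) (simp_all add: algebra_simps)

lemma contract_eq_0:
  assumes "\<And>ys y zs. xs = ys @ y # zs \<Longrightarrow> \<phi> y = 0 \<or> F (ys @ zs) = 0"
  shows "contract \<phi> F xs = 0"
  using assms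
proof (induction xs arbitrary: F)
  case (Cons x xs)
  have "contract \<phi> (\<lambda>l. F (x # l)) xs = 0"
    by (rule Cons.IH) (use Cons.prems[of "x # ys" for ys] in auto)
  then show ?case using Cons.prems[of "[]" x xs] by auto
qed simp

text \<open>
  Removing \<open>x\<close> before or after an element on its right differs by one place, hence by a sign.
\<close>

lemma contract_anticommute:
  "contract \<phi> (contract \<psi> F) xs = - contract \<psi> (contract \<phi> F) xs"
proof (induction xs arbitrary: F)
  case (Cons x xs)
  show ?case
    using Cons.IH[of "\<lambda>l. F (x # l)"]
    by (simp add: contract_diff contract_scale)
qed simp

lemma contract_swap:
  assumes "\<And>xs ys. F (xs @ b # a # ys) = - F (xs @ a # b # ys)"
  shows "contract \<phi> F (xs @ b # a # ys) = - contract \<phi> F (xs @ a # b # ys)"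
  using assms
proof (induction xs arbitrary: F)
  case Nil
  have "contract \<phi> (\<lambda>l. F (b # a # l)) ys = - contract \<phi> (\<lambda>l. F (a # b # l)) ys"
    using Nil[of "[]"] by (simp add: contract_minus)
  then show ?case by simp
next
  case (Cons x xs)
  have "contract \<phi> (\<lambda>l. F (x # l)) (xs @ b # a # ys) = - contract \<phi> (\<lambda>l. F (x # l)) (xs @ a # b # ys)"
    by (rule Cons.IH) (use Cons.prems[of "x # xs" for xs] in simp)
  then show ?case using Cons.prems by simp
qed

text \<open>
  Away from the front, contraction preserves the alternating property.  At the front, the exchange
  compares two successive contractions, which anticommute.
\<close>

lemma pfaff_swap:
  assumes B: "\<And>x y. B y x = - B x y"
  shows "pfaff B n (xs @ b # a # ys) = - pfaff B n (xs @ a # b # ys)"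
proof (induction n arbitrary: xs ys)
  case (Suc n)
  show ?case
  proof (cases xs)
    case Nil
    have "contract (B b) (\<lambda>l. pfaff B n (a # l)) ys = - contract (B a) (\<lambda>l. pfaff B n (b # l)) ys"
    proof (cases n)
      case 0
      then show ?thesis by (simp add: contract_eq_0)
    next
      case (Suc k)
      then show ?thesis by (simp add: contract_anticommute[of "B b"])
    qed
    then show ?thesis using Nil B[of a b] by simp
  next
    case (Cons x xs')
    then show ?thesis using contract_swap[of "pfaff B n" b a, OF Suc.IH] by simp
  qed
qed simp

lemma pfaff_move:
  assumes B: "\<And>x y. B y x = - B x y"
  shows "pfaff B n (xs @ ys @ a # zs) = (- 1) ^ length ys * pfaff B n (xs @ a # ys @ zs)"
proof (induction ys arbitrary: xs)
  case (Cons y ys)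
  have "pfaff B n (xs @ (y # ys) @ a # zs) = (- 1) ^ length ys * pfaff B n ((xs @ [y]) @ a # ys @ zs)"
    using Cons.IH[of "xs @ [y]"] by simp
  also have "pfaff B n ((xs @ [y]) @ a # ys @ zs) = - pfaff B n (xs @ a # y # ys @ zs)"
    using pfaff_swap[of B n xs y a "ys @ zs", OF B] by simp
  finally show ?case by simp
qed simp

lemma pfaff_repeat:
  fixes B :: "'a \<Rightarrow> 'a \<Rightarrow> 'r :: comm_ring_1"
  assumes B: "\<And>x y. B y x = - B x y" and two: "\<And>c :: 'r. c = - c \<Longrightarrow> c = 0"
    and a: "a \<in> set xs"
  shows "pfaff B n (xs @ a # zs) = 0"
proof -
  obtain us vs where xs: "xs = us @ a # vs" using a by (meson split_list)
  have "pfaff B n (us @ a # a # vs @ zs) = 0"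
    by (rule two, rule pfaff_swap[OF B])
  then show ?thesis using pfaff_move[of B n "us @ [a]" vs a zs, OF B] by (simp add: xs)
qed

lemma contract_additive:
  assumes "\<And>xs ys. F (xs @ v # ys) = c * F (xs @ u # ys) + d * F (xs @ t # ys)"
    and "\<phi> v = c * \<phi> u + d * \<phi> t"
  shows "contract \<phi> F (xs @ v # ys) = c * contract \<phi> F (xs @ u # ys) + d * contract \<phi> F (xs @ t # ys)"
  using assms(1)
proof (induction xs arbitrary: F)
  case Nil
  have "contract \<phi> (\<lambda>l. F (v # l)) ys
      = c * contract \<phi> (\<lambda>l. F (u # l)) ys + d * contract \<phi> (\<lambda>l. F (t # l)) ys"
    using Nil[of "[]"] by (simp add: contract_add contract_scale)
  then show ?case by (simp add: assms(2) algebra_simps)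
next
  case (Cons x xs)
  have "contract \<phi> (\<lambda>l. F (x # l)) (xs @ v # ys)
      = c * contract \<phi> (\<lambda>l. F (x # l)) (xs @ u # ys) + d * contract \<phi> (\<lambda>l. F (x # l)) (xs @ t # ys)"
    by (rule Cons.IH) (use Cons.prems[of "x # xs" for xs] in simp)
  then show ?case using Cons.prems by (simp add: algebra_simps)
qed

lemma pfaff_additive:
  assumes "\<And>x. B x v = c * B x u + d * B x t" "\<And>x. B v x = c * B u x + d * B t x"
  shows "pfaff B n (xs @ v # ys) = c * pfaff B n (xs @ u # ys) + d * pfaff B n (xs @ t # ys)"
proof (induction n arbitrary: xs ys)
  case (Suc n)
  show ?case
  proof (cases xs)
    case Nil
    have Bv: "B v = (\<lambda>x. c * B u x + d * B t x)" using assms(2) by auto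
    have "contract (\<lambda>x. c * B u x + d * B t x) (pfaff B n) ys
        = c * contract (B u) (pfaff B n) ys + d * contract (B t) (pfaff B n) ys"
      using contract_add_left[of "\<lambda>x. c * B u x" d "B t"] contract_add_left[of "\<lambda>x. 0" c "B u"] 
      by (simp add: contract_eq_0)
    then show ?thesis using Nil Bv by simp
  next
    case (Cons x xs')
    then show ?thesis
      using contract_additive[of "pfaff B n" v c u d t "B x", OF Suc.IH assms(1)] by simp
  qed
qed simp

lemma contract_closed:
  "contract \<phi> F xs = (\<Sum>k<length xs. (- 1) ^ k * \<phi> (xs ! k) * F (take k xs @ drop (Suc k) xs))"
  by (induction xs arbitrary: F)
    (simp_all add: sum.lessThan_Suc_shift sum_negf del: sum.lessThan_Suc)

lemma contract_map: "contract (\<lambda>x. \<phi> (f x)) (\<lambda>l. F (map f l)) xs = contract \<phi> F (map f xs)"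
proof (induction xs arbitrary: F)
  case (Cons x xs)
  show ?case using Cons.IH[of "\<lambda>l. F (f x # l)"] by simp
qed simp

lemma pfaff_map: "pfaff (\<lambda>x y. B (f x) (f y)) n xs = pfaff B n (map f xs)"
proof (induction n arbitrary: xs)
  case (Suc n)
  then have "pfaff (\<lambda>x y. B (f x) (f y)) n = (\<lambda>l. pfaff B n (map f l))" by auto
  then show ?case by (cases xs) (simp_all add: contract_map)
qed simp

text \<open>
  Some pair in every perfect matching consists of two elements of \<open>vs\<close>, because there are more of
  them than there are other elements.
\<close>

lemma pfaff_isotropic_0:
  assumes "length xs < length vs" and "\<And>v v'. v \<in> set vs \<Longrightarrow> v' \<in> set vs \<Longrightarrow> B v v' = 0"
  shows "pfaff B n (xs @ vs) = 0"
  using assms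
proof (induction n arbitrary: xs vs)
  case (Suc n)
  show ?case
  proof (cases xs)
    case Nil
    then obtain v ws where "vs = v # ws" using Suc.prems by (cases vs) auto
    then show ?thesis using Nil Suc.prems by (auto intro!: contract_eq_0)
  next
    case (Cons x xs')
    have "contract (B x) (pfaff B n) (xs' @ vs) = 0"
    proof (rule contract_eq_0, rule disjI2)
      fix ys y zs assume "xs' @ vs = ys @ y # zs"
      then consider us where "xs' = ys @ y # us" "zs = us @ vs"
        | us where "ys = xs' @ us" "vs = us @ y # zs"
        by (metis append_eq_append_conv2 append_Nil append_Nil2 Cons_eq_append_conv)
      then show "pfaff B n (ys @ zs) = 0"
      proof cases
        case 1
        then show ?thesis using Suc.IH[of "ys @ us" vs] Suc.prems Cons by simp
      next
        case 2
        then show ?thesis using Suc.IH[of xs' "us @ zs"] Suc.prems Cons by simp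
      qed
    qed
    then show ?thesis using Cons by simp
  qed
qed auto

text \<open>
  The terms that remove an element of \<open>xs\<close> vanish.  This is how the isotropic part of a list absorbs the
  contraction.
\<close>

lemma contract_skip:
  assumes "\<And>ys. length ys < length xs \<Longrightarrow> F (ys @ vs) = 0"
  shows "contract \<phi> F (xs @ vs) = (- 1) ^ length xs * contract \<phi> (\<lambda>l. F (xs @ l)) vs"
  using assms
proof (induction xs arbitrary: F)
  case (Cons x xs)
  have "contract \<phi> (\<lambda>l. F (x # l)) (xs @ vs)
      = (- 1) ^ length xs * contract \<phi> (\<lambda>l. F (x # xs @ l)) vs"
    using Cons.prems[of "x # ys" for ys] by (intro Cons.IH) simp
  then show ?case using Cons.prems[of xs] by simp
qed simp

text \<open>
  Only the matchings of all \<open>us\<close> to all \<open>vs\<close> survive.  With \<open>us\<close> reversed, the matching of \<open>us ! i\<close> to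
  \<open>vs ! i\<close> for all \<open>i\<close> is nested, so it has no crossings and its sign is positive, as for the diagonal
  of the determinant.  Expanding the Pfaffian along its first element is the Laplace expansion along the
  last row.
\<close>

lemma pfaff_isotropic_det:
  assumes "length us = n" "length vs = n" "\<And>v v'. v \<in> set vs \<Longrightarrow> v' \<in> set vs \<Longrightarrow> B v v' = 0"
  shows "pfaff B n (rev us @ vs) = det (mat n n (\<lambda>(i, j). B (us ! i) (vs ! j)))"
  using assms
proof (induction n arbitrary: us vs)
  case 0
  then show ?case by (simp add: det_dim_zero)
next
  case (Suc n)
  obtain us' u where us: "us = us' @ [u]" using Suc.prems(1) by (cases us rule: rev_cases) auto
  have len: "length us' = n" using Suc.prems us by simp
  let ?A = "mat (Suc n) (Suc n) (\<lambda>(i, j). B (us ! i) (vs ! j))"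
  have "pfaff B (Suc n) (rev us @ vs) = contract (B u) (pfaff B n) (rev us' @ vs)" by (simp add: us)
  also have "\<dots> = (- 1) ^ n * contract (B u) (\<lambda>l. pfaff B n (rev us' @ l)) vs"
    using contract_skip[of "rev us'" "pfaff B n" vs "B u"] pfaff_isotropic_0[of _ vs B n] Suc.prems len by simp
  also have "\<dots> = (\<Sum>k<Suc n. (- 1) ^ (n + k) * B u (vs ! k) * pfaff B n (rev us' @ take k vs @ drop (Suc k) vs))"
    by (simp add: contract_closed Suc.prems(2) sum_distrib_left power_add mult.assoc del: sum.lessThan_Suc)
  also have "\<dots> = (\<Sum>k<Suc n. ?A $$ (n, k) * cofactor ?A n k)"
  proof (rule sum.cong[OF refl])
    fix k assume "k \<in> {..<Suc n}"
    then have k: "k \<le> n" by simp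
    have "pfaff B n (rev us' @ take k vs @ drop (Suc k) vs)
        = det (mat n n (\<lambda>(i, j). B (us' ! i) ((take k vs @ drop (Suc k) vs) ! j)))"
      using Suc.prems(2,3) len k by (intro Suc.IH) (auto dest: in_set_takeD in_set_dropD)
    also have "mat n n (\<lambda>(i, j). B (us' ! i) ((take k vs @ drop (Suc k) vs) ! j)) = mat_delete ?A n k"
      using k len Suc.prems(2) by (intro eq_matI) (auto simp: mat_delete_def us nth_append)
    finally show "(- 1) ^ (n + k) * B u (vs ! k) * pfaff B n (rev us' @ take k vs @ drop (Suc k) vs)
        = ?A $$ (n, k) * cofactor ?A n k"
      using k len by (simp add: cofactor_def us nth_append mult_ac)
  qed
  also have "\<dots> = det ?A" by (rule laplace_expansion_row[symmetric]) auto
  finally show ?case .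
qed


section \<open>The series \<open>F\<close> and its signed variant in finitely many variables\<close>

text \<open>
  The series \<open>F\<^sub>d\<close> or its signed variant with all variables set to zero: the coefficient of \<open>t\<^sup>d\<close> in \<open>\<Sum>\<^sub>k s\<^sup>k t\<^sup>N\<^sup>k\<close>, for \<open>s = \<plusminus>1\<close>.
\<close>

definition winding_sign :: "int \<Rightarrow> nat \<Rightarrow> int \<Rightarrow> int" where
  "winding_sign s N d = (if int N dvd d then if even (d div int N) then 1 else s else 0)"

lemma winding_sign_minus: "winding_sign s N (- d) = winding_sign s N d"
  by (cases "int N dvd d") (auto simp: winding_sign_def dvd_neg_div)

lemma winding_sign_shift:
  assumes "N > 0" "s * s = 1"
  shows "winding_sign s N (d + int N) = s * winding_sign s N d"
  using assms by (auto simp: winding_sign_def)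

definition signed_F :: "int \<Rightarrow> int \<Rightarrow> nat \<Rightarrow> int mfps" where
  "signed_F s r N = mfps_sum (\<lambda>k::int. (if even k then 1 else of_int s) * f_series (r + int N * k)) UNIV"

lemma F_series_signed_F: "F_series r N = signed_F 1 r N"
  by (simp add: F_series_def signed_F_def cong: if_cong)

lemma Fbar_series_signed_F: "Fbar_series r N = signed_F (- 1) r N"
  by (simp add: Fbar_series_def signed_F_def cong: if_cong)

definition squarefree_mset :: "nat multiset \<Rightarrow> bool" where
  "squarefree_mset A \<longleftrightarrow> 0 \<notin># A \<and> (\<forall>i. count A i \<le> 1)"

text \<open>
  The ways to write a monomial as a term of \<open>e\<^sub>i\<close> times a term of \<open>e\<^sub>j\<close>, for arbitrary \<open>i\<close> and \<open>j\<close>.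
\<close>

definition splittings :: "nat multiset \<Rightarrow> nat multiset set" where
  "splittings M = {A. A \<subseteq># M \<and> squarefree_mset A \<and> squarefree_mset (M - A)}"

lemma finite_splittings: "finite (splittings M)"
  unfolding splittings_def by (rule finite_subset[OF _ finite_submultisets[of M]]) auto

lemma squarefree_msetD: "squarefree_mset A \<Longrightarrow> mset_set (set_mset A) = A"
  by (rule multiset_eqI) (metis One_nat_def count_eq_zero_iff count_mset_set(1,3) finite_set_mset le_Suc_eq le_zero_eq squarefree_mset_def)

lemma squarefree_mset_set: "0 \<notin> S \<Longrightarrow> squarefree_mset (mset_set S)"
  by (cases "finite S") (auto simp: squarefree_mset_def count_mset_set')

lemma coef_elem_sym: "coef (elem_sym n) A = (if squarefree_mset A \<and> int (size A) = n then 1 else 0)"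
proof -
  let ?I = "{S. finite S \<and> S \<subseteq> {1..} \<and> int (card S) = n}"
  let ?c = "\<lambda>S. coef (\<Prod>i\<in>S. var i) A"
  let ?Q = "if squarefree_mset A then {A} else {}"
  have c: "?c S = (\<Sum>q\<in>?Q. if set_mset q = S then 1 else 0)" if "S \<in> ?I" for S
  proof -
    have fin: "finite S" and S: "0 \<notin> S" using that by auto
    have "(\<Prod>i\<in>S. var i) = (\<Prod>i\<in>#mset_set S. var i)" by (simp add: prod_unfold_prod_mset)
    then have "?c S = (if A = mset_set S then 1 else 0)" by (simp only: coef_monomial)
    also have "A = mset_set S \<longleftrightarrow> squarefree_mset A \<and> set_mset A = S"
      using squarefree_mset_set[OF S] squarefree_msetD[of A] fin by auto
    finally show ?thesis by simp
  qed
  have "coef (elem_sym n) A = (\<Sum>q\<in>{q \<in> ?Q. set_mset q \<in> ?I}. 1)"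
    unfolding elem_sym_def coef_mfps_sum by (rule sum_over_fibres[OF _ c]) auto
  also have "\<dots> = (if squarefree_mset A \<and> int (size A) = n then 1 else 0)"
  proof (cases "squarefree_mset A")
    case True
    then have "card (set_mset A) = size A" using squarefree_msetD[of A] by (metis size_mset_set)
    moreover have "set_mset A \<subseteq> {1..}" using True by (auto simp: squarefree_mset_def Suc_le_eq intro: gr0I)
    ultimately show ?thesis using True by (auto simp: Collect_conv_if)
  qed simp
  finally show ?thesis .
qed

lemma coef_f_series:
  "coef (f_series r) M = (\<Sum>A\<in>splittings M. if int (size M) - 2 * int (size A) = r then 1 else 0)"
proof -
  let ?v = "\<lambda>A. if int (size M) - 2 * int (size A) = r then 1 else 0 :: int"
  have c: "coef (elem_sym i * elem_sym (i + r)) M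
      = (\<Sum>A\<in>splittings M. if int (size A) = i then ?v A else 0)" for i
  proof -
    have "coef (elem_sym i * elem_sym (i + r)) M
        = (\<Sum>A\<in>{A. A \<subseteq># M}. if A \<in> splittings M then if int (size A) = i then ?v A else 0 else 0)"
      unfolding coef_times by (intro sum.cong) (auto simp: coef_elem_sym splittings_def size_Diff_submset size_mset_mono of_nat_diff)
    also have "\<dots> = (\<Sum>A\<in>splittings M. if int (size A) = i then ?v A else 0)"
      by (subst sum.inter_restrict[symmetric]) (auto simp: finite_submultisets splittings_def intro!: sum.cong)
    finally show ?thesis .
  qed
  show ?thesis unfolding f_series_def coef_mfps_sum
    by (subst sum_over_fibres[OF finite_splittings c]) auto
qed

lemma coef_signed_F:
  assumes "N > 0"
  shows "coef (signed_F s r N) M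
    = (\<Sum>A\<in>splittings M. winding_sign s N (int (size M) - 2 * int (size A) - r))"
proof -
  let ?d = "\<lambda>A. int (size M) - 2 * int (size A) - r"
  let ?Q = "{A \<in> splittings M. int N dvd ?d A}"
  have c: "coef ((if even k then 1 else of_int s) * f_series (r + int N * k)) M
      = (\<Sum>A\<in>?Q. if ?d A div int N = k then winding_sign s N (?d A) else 0)" for k
  proof -
    have "coef ((if even k then 1 else of_int s) * f_series (r + int N * k)) M
        = (if even k then 1 else s) * coef (f_series (r + int N * k)) M"
      by (simp add: coef_of_int_times)
    also have "\<dots> = (\<Sum>A\<in>splittings M. if int N dvd ?d A then if ?d A div int N = k then winding_sign s N (?d A) else 0 else 0)"
      unfolding coef_f_series sum_distrib_left
    proof (intro sum.cong refl)
      fix A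
      have "int (size M) - 2 * int (size A) = r + int N * k \<longleftrightarrow> ?d A = int N * k" by auto
      also have "\<dots> \<longleftrightarrow> int N dvd ?d A \<and> ?d A div int N = k" using assms by auto
      finally show "(if even k then 1 else s) * (if int (size M) - 2 * int (size A) = r + int N * k then 1 else 0)
        = (if int N dvd ?d A then if ?d A div int N = k then winding_sign s N (?d A) else 0 else 0)"
        by (auto simp: winding_sign_def)
    qed
    also have "\<dots> = (\<Sum>A\<in>?Q. if ?d A div int N = k then winding_sign s N (?d A) else 0)"
      using finite_splittings[of M] by (subst sum.inter_filter) auto
    finally show ?thesis .
  qed
  have "coef (signed_F s r N) M = (\<Sum>A\<in>?Q. winding_sign s N (?d A))"
    unfolding signed_F_def coef_mfps_sum
    by (subst sum_over_fibres[OF _ c]) (use finite_splittings[of M] in auto)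
  also have "\<dots> = (\<Sum>A\<in>splittings M. winding_sign s N (?d A))"
    by (rule sum.mono_neutral_left) (use finite_splittings[of M] in \<open>auto simp: winding_sign_def\<close>)
  finally show ?thesis .
qed

text \<open>
  The restriction of \<open>signed_F\<close> to the variables in a list.  The generating function of all \<open>f\<^sub>r\<close> is
  \<open>\<Prod>\<^sub>i (1 + x\<^sub>i t) (1 + x\<^sub>i / t)\<close>, and a new variable \<open>x\<close> contributes the factor
  \<open>1 + x\<^sup>2 + x (t + 1 / t)\<close>.
\<close>

primrec signed_F_in :: "int \<Rightarrow> nat \<Rightarrow> nat list \<Rightarrow> int \<Rightarrow> int mfps" where
  "signed_F_in s N [] r = of_int (winding_sign s N r)"
| "signed_F_in s N (k # ks) r = (1 + var k * var k) * signed_F_in s N ks r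
     + var k * (signed_F_in s N ks (r - 1) + signed_F_in s N ks (r + 1))"

lemma signed_F_in_minus: "signed_F_in s N ks (- r) = signed_F_in s N ks r"
proof (induction ks arbitrary: r)
  case (Cons k ks)
  have "- r - 1 = - (r + 1)" "- r + 1 = - (r - 1)" by simp_all
  then show ?case by (simp only: signed_F_in.simps Cons.IH) (simp add: add.commute)
qed (simp add: winding_sign_minus)

lemma signed_F_in_shift:
  assumes "N > 0" "s * s = 1"
  shows "signed_F_in s N ks (r + int N) = of_int s * signed_F_in s N ks r"
proof (induction ks arbitrary: r)
  case (Cons k ks)
  show ?case using Cons.IH[of r] Cons.IH[of "r - 1"] Cons.IH[of "r + 1"]
    by (simp add: algebra_simps)
qed (simp add: winding_sign_shift[OF assms])

lemma squarefree_add_mset: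
  "squarefree_mset (add_mset k A) \<longleftrightarrow> k \<noteq> 0 \<and> k \<notin># A \<and> squarefree_mset A"
proof -
  have "(\<forall>i. count (add_mset k A) i \<le> 1) \<longleftrightarrow> count A k = 0 \<and> (\<forall>i. count A i \<le> 1)"
    by (metis (full_types) One_nat_def Suc_le_mono count_add_mset le_zero_eq zero_le_one)
  then show ?thesis by (auto simp: squarefree_mset_def not_in_iff)
qed

lemma subseteq_add_mset_absent:
  assumes "A \<subseteq># add_mset k M" "k \<notin># A"
  shows "A \<subseteq># M"
  unfolding subseteq_mset_def
proof
  fix i
  have "count A i \<le> count (add_mset k M) i" using assms(1) by (simp add: subseteq_mset_def)
  then show "count A i \<le> count M i" using assms(2) by (cases "i = k") (auto simp: not_in_iff)
qed

lemma splittings_add_new: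
  assumes "k \<noteq> 0" "k \<notin># M"
  shows "splittings (add_mset k M) = splittings M \<union> add_mset k ` splittings M"
proof (intro equalityI subsetI)
  fix A assume A: "A \<in> splittings (add_mset k M)"
  show "A \<in> splittings M \<union> add_mset k ` splittings M"
  proof (cases "k \<in># A")
    case True
    then obtain B where "A = add_mset k B" by (metis insert_DiffM)
    then show ?thesis using A by (auto simp: splittings_def squarefree_add_mset)
  next
    case False
    then have "add_mset k M - A = add_mset k (M - A)" by simp
    moreover have "A \<subseteq># M"
      using A False by (auto simp: splittings_def intro: subseteq_add_mset_absent)
    ultimately show ?thesis using A by (auto simp: splittings_def squarefree_add_mset)
  qed
next
  fix A assume "A \<in> splittings M \<union> add_mset k ` splittings M"
  then consider "A \<in> splittings M" | B where "B \<in> splittings M" "A = add_mset k B" by auto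
  then show "A \<in> splittings (add_mset k M)"
  proof cases
    case 1
    then have "k \<notin># A" "k \<notin># M - A" using assms
      by (auto simp: splittings_def dest: mset_subset_eqD in_diffD)
    moreover have "add_mset k M - A = add_mset k (M - A)" using \<open>k \<notin># A\<close> by simp
    moreover have "A \<subseteq># add_mset k M"
      using 1 by (auto simp: splittings_def intro: subset_mset.order_trans)
    ultimately show ?thesis using 1 assms by (simp add: splittings_def squarefree_add_mset)
  next
    case 2
    then have "k \<notin># B" using assms by (auto simp: splittings_def dest: mset_subset_eqD)
    then show ?thesis using 2 assms by (simp add: splittings_def squarefree_add_mset)
  qed
qed

lemma splittings_add_twice:
  assumes "k \<noteq> 0" "k \<notin># M"
  shows "splittings (add_mset k (add_mset k M)) = add_mset k ` splittings M"
proof (intro equalityI subsetI)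
  fix A assume A: "A \<in> splittings (add_mset k (add_mset k M))"
  have "k \<in># A"
  proof (rule ccontr)
    assume "k \<notin># A"
    then have "add_mset k (add_mset k M) - A = add_mset k (add_mset k (M - A))" by simp
    then show False using A by (simp add: splittings_def squarefree_add_mset)
  qed
  then obtain B where B: "A = add_mset k B" by (metis insert_DiffM)
  then have k: "k \<notin># B" using A by (simp add: splittings_def squarefree_add_mset)
  then have "add_mset k M - B = add_mset k (M - B)" by simp
  moreover have "B \<subseteq># M"
    using A B k by (auto simp: splittings_def intro: subseteq_add_mset_absent)
  ultimately show "A \<in> add_mset k ` splittings M"
    using A B by (auto simp: splittings_def squarefree_add_mset)
next
  fix A assume "A \<in> add_mset k ` splittings M"
  then obtain B where B: "B \<in> splittings M" "A = add_mset k B" by auto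
  then have k: "k \<notin># B" "k \<notin># M - B"
    using assms by (auto simp: splittings_def dest: mset_subset_eqD in_diffD)
  then have "add_mset k M - B = add_mset k (M - B)" by simp
  moreover have "B \<subseteq># add_mset k M"
    using B by (auto simp: splittings_def intro: subset_mset.order_trans)
  ultimately show "A \<in> splittings (add_mset k (add_mset k M))"
    using B k assms by (simp add: splittings_def squarefree_add_mset)
qed

lemma splittings_thrice: "splittings (add_mset k (add_mset k (add_mset k M))) = {}"
proof (rule equals0I)
  fix A assume A: "A \<in> splittings (add_mset k (add_mset k (add_mset k M)))"
  let ?M = "add_mset k (add_mset k (add_mset k M))"
  have "count A k \<le> 1" "count (?M - A) k \<le> 1"
    using A unfolding splittings_def squarefree_mset_def by blast+
  then show False by simp
qed

text \<open>
  A new variable occurs in a splitting not at all, in one of the two factors, or in both.  These are the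
  terms \<open>1\<close>, \<open>x (t + 1 / t)\<close> and \<open>x\<^sup>2\<close> of the recursion.
\<close>

lemma coef_signed_F_in:
  assumes "distinct ks" "0 \<notin> set ks"
  shows "coef (signed_F_in s N ks r) M = (if set_mset M \<subseteq> set ks
    then \<Sum>A\<in>splittings M. winding_sign s N (int (size M) - 2 * int (size A) - r) else 0)"
  using assms
proof (induction ks arbitrary: r M)
  case Nil
  have "splittings {#} = {{#}}" by (auto simp: splittings_def squarefree_mset_def)
  then show ?case
    using coef_of_int_times[of "winding_sign s N r" 1 M] by (auto simp: winding_sign_minus)
next
  case (Cons k ks)
  have k: "k \<noteq> 0" "k \<notin> set ks" using Cons.prems by auto
  note IH = Cons.IH[OF distinct_tl[OF Cons.prems(1), simplified]]
  let ?c = "\<lambda>r M. coef (signed_F_in s N ks r) M"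
  have step: "coef (signed_F_in s N (k # ks) r) M = ?c r M
     + (if k \<in># M then (if k \<in># M - {#k#} then ?c r (M - {#k#} - {#k#}) else 0)
          + ?c (r - 1) (M - {#k#}) + ?c (r + 1) (M - {#k#}) else 0)"
    by (simp add: distrib_right mult.assoc coef_var_times)
  have inj: "inj_on (add_mset k) X" for X by (simp add: inj_on_def)
  have zero: "?c r' M' = 0" if "k \<in># M'" for r' M'
    using that k IH Cons.prems by auto
  consider "k \<notin># M" | M' where "M = add_mset k M'" "k \<notin># M'"
    | M' where "M = add_mset k (add_mset k M')" "k \<notin># M'"
    | M' where "M = add_mset k (add_mset k (add_mset k M'))"
    by (metis insert_DiffM)
  then show ?case
  proof cases
    case 1
    then show ?thesis using IH Cons.prems step by auto
  next
    case 2
    let ?t = "\<lambda>r. \<Sum>A\<in>splittings M'. winding_sign s N (int (size M') - 2 * int (size A) - r)"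
    have "splittings M' \<inter> add_mset k ` splittings M' = {}"
      using 2(2) by (auto simp: splittings_def dest: mset_subset_eqD)
    then have "(\<Sum>A\<in>splittings M. winding_sign s N (int (size M) - 2 * int (size A) - r))
        = ?t (r - 1) + ?t (r + 1)"
      unfolding 2(1) splittings_add_new[OF k(1) 2(2)]
      by (simp add: sum.union_disjoint finite_splittings sum.reindex[OF inj] algebra_simps)
    moreover have "set_mset M \<subseteq> set (k # ks) \<longleftrightarrow> set_mset M' \<subseteq> set ks" using 2 by auto
    ultimately show ?thesis using step zero[of M r] 2 IH Cons.prems by simp
  next
    case 3
    have "(\<Sum>A\<in>splittings M. winding_sign s N (int (size M) - 2 * int (size A) - r))
        = (\<Sum>A\<in>splittings M'. winding_sign s N (int (size M') - 2 * int (size A) - r))"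
      unfolding 3(1) splittings_add_twice[OF k(1) 3(2)]
      by (simp add: sum.reindex[OF inj] algebra_simps)
    moreover have "set_mset M \<subseteq> set (k # ks) \<longleftrightarrow> set_mset M' \<subseteq> set ks" using 3 by auto
    ultimately show ?thesis using step zero 3 IH Cons.prems by simp
  next
    case 4
    then show ?thesis using step zero by (simp add: splittings_thrice)
  qed
qed

lemma restrict_signed_F:
  assumes "N > 0"
  shows "restrict_vars {..n} (signed_F s r N) = signed_F_in s N [1..<Suc n] r"
proof (rule mfps_eqI)
  fix M :: "nat multiset"
  show "coef (restrict_vars {..n} (signed_F s r N)) M = coef (signed_F_in s N [1..<Suc n] r) M"
  proof (cases "0 \<in># M")
    case True
    have "splittings M = {}"
    proof (rule equals0I)
      fix A assume "A \<in> splittings M"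
      then have "0 \<notin># A" "0 \<notin># M - A" "A \<subseteq># M"
        unfolding splittings_def squarefree_mset_def by blast+
      then show False using True by (metis subset_mset.add_diff_inverse union_iff)
    qed
    then show ?thesis by (simp add: coef_restrict_vars coef_signed_F[OF assms] coef_signed_F_in del: upt_Suc)
  next
    case False
    then have "set_mset M \<subseteq> {..n} \<longleftrightarrow> set_mset M \<subseteq> set [1..<Suc n]"
      by (auto simp: less_Suc_eq_le Suc_le_eq simp del: upt_Suc intro: gr0I)
    then show ?thesis by (simp add: coef_restrict_vars coef_signed_F[OF assms] coef_signed_F_in del: upt_Suc)
  qed
qed


section \<open>Toeplitz Pfaffians as determinants\<close>

lemma sum_telescope2:
  fixes G :: "int \<Rightarrow> 'r :: comm_ring_1"
  shows "(\<Sum>b\<in>{c - 1 - int j..c + int j}. G (c + i - b - 1) - G (c + i - b + 1))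
    = G (i - int j - 1) + G (i - int j) - G (i + int j + 1) - G (i + int j + 2)"
proof (induction j)
  case 0
  have "{c - 1 - int 0..c + int 0} = {c - 1, c}" by auto
  then show ?case by (simp add: algebra_simps)
next
  case (Suc j)
  have "{c - 1 - int (Suc j)..c + int (Suc j)}
      = insert (c - 2 - int j) (insert (c + 1 + int j) {c - 1 - int j..c + int j})" by auto
  then show ?case using Suc by (simp add: algebra_simps)
qed

text \<open>
  A form of Gordon's lemma.  The kernel is extended to sets of integers, a set standing for the sum of
  its elements.  The intervals \<open>v k = {h - k..<h + k}\<close> are invariant under the reflection \<open>a \<mapsto> 2h - 1 - a\<close>, which
  reverses the sign of the kernel, so they are isotropic.  Since \<open>v (k + 1)\<close> arises from the single point
  \<open>h - 1 - k\<close> by adding arguments that are present elsewhere, the points \<open>0, \<dots>, h - 1\<close> may be replaced by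
  the intervals.  The resulting determinant has entries \<open>M i j + M (i - 1) j\<close>, where \<open>M\<close> is the
  matrix in the claim.
\<close>

lemma pfaff_toeplitz:
  fixes G :: "int \<Rightarrow> int mfps"
  assumes G: "\<And>r. G (- r) = G r"
  shows "pfaff (\<lambda>a b. G (a - b - 1) - G (a - b + 1)) h (map int (rev [0..<2 * h]))
    = det (mat h h (\<lambda>(i, j). G (int i - int j) - G (int i + int j + 2)))"
proof -
  define g where "g a b = G (a - b - 1) - G (a - b + 1)" for a b :: int
  define B where "B S T = (\<Sum>a\<in>S. \<Sum>b\<in>T. g a b)" for S T :: "int set"
  have g_anti: "g b a = - g a b" for a b
    using G[of "a - b - 1"] G[of "a - b + 1"] by (simp add: g_def algebra_simps)
  have B_anti: "B T S = - B S T" for S T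
  proof -
    have "B T S = (\<Sum>b\<in>S. \<Sum>a\<in>T. g a b)" unfolding B_def by (rule sum.swap)
    also have "\<dots> = (\<Sum>b\<in>S. \<Sum>a\<in>T. - g b a)" by (intro sum.cong refl g_anti)
    finally show ?thesis by (simp add: B_def sum_negf)
  qed
  define u where "u k = {int h + int k}" for k
  define w where "w k = {int h - 1 - int k}" for k
  define v where "v k = {int h - int k..<int h + int k}" for k
  have B_Un: "B (S \<union> T) X = B S X + B T X" "B X (S \<union> T) = B X S + B X T"
    if "S \<inter> T = {}" "finite S" "finite T" for S T X
    using that by (simp_all add: B_def sum.union_disjoint sum.distrib)
  let ?us = "rev (map u [0..<h])"
  have initial: "map (\<lambda>a. {a}) (map int (rev [0..<2 * h])) = ?us @ map w [0..<h]"
    by (rule nth_equalityI) (auto simp: u_def w_def nth_append rev_nth of_nat_diff)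
  have replace: "pfaff B h (?us @ map (\<lambda>i. v (Suc i)) [0..<k] @ map w [k..<h]) = pfaff B h (?us @ map w [0..<h])"
    if "k \<le> h" for k
    using that
  proof (induction k)
    case (Suc k)
    let ?X = "?us @ map (\<lambda>i. v (Suc i)) [0..<k]"
    let ?Y = "map w [Suc k..<h]"
    have un: "v (Suc k) = w k \<union> (u k \<union> v k)" "w k \<inter> (u k \<union> v k) = {}" "u k \<inter> v k = {}"
      and fin: "finite (u k)" "finite (v k)" "finite (w k)"
      by (auto simp: v_def w_def u_def)
    have 1: "pfaff B h (?X @ v (Suc k) # ?Y)
        = 1 * pfaff B h (?X @ w k # ?Y) + 1 * pfaff B h (?X @ (u k \<union> v k) # ?Y)"
      by (rule pfaff_additive) (simp_all add: un B_Un fin)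
    have 2: "pfaff B h (?X @ (u k \<union> v k) # ?Y)
        = 1 * pfaff B h (?X @ u k # ?Y) + 1 * pfaff B h (?X @ v k # ?Y)"
      by (rule pfaff_additive) (simp_all add: un B_Un fin)
    have 3: "pfaff B h (?X @ u k # ?Y) = 0"
      by (rule pfaff_repeat[OF B_anti mfps_no_2_torsion]) (use Suc.prems in auto)
    \<comment> \<open>For \<open>k = 0\<close> the interval is empty and stands for the zero vector.\<close>
    have 4: "pfaff B h (?X @ v k # ?Y) = 0"
    proof (cases k)
      case 0
      then have "pfaff B h (?X @ v k # ?Y) = 0 * pfaff B h (?X @ v k # ?Y) + 0 * pfaff B h (?X @ v k # ?Y)"
        by (intro pfaff_additive) (simp_all add: B_def v_def)
      then show ?thesis by simp
    next
      case (Suc k')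
      show ?thesis
        by (rule pfaff_repeat[OF B_anti mfps_no_2_torsion]) (use Suc in auto)
    qed
    have "map w [k..<h] = w k # ?Y" using Suc.prems by (simp add: upt_conv_Cons)
    then have "pfaff B h (?X @ w k # ?Y) = pfaff B h (?us @ map w [0..<h])"
      using Suc by simp
    then show ?case using 1 2 3 4 by simp
  qed simp
  have isotropic: "B (v i) (v j) = 0" for i j
  proof (rule mfps_no_2_torsion)
    have "B (v i) (v j) = (\<Sum>a\<in>v i. \<Sum>b\<in>v j. g (2 * int h - 1 - a) (2 * int h - 1 - b))"
      unfolding B_def
      by (intro sum.reindex_bij_witness[of "v i" "\<lambda>a. 2 * int h - 1 - a" "\<lambda>a. 2 * int h - 1 - a"]
          sum.reindex_bij_witness[of "v j" "\<lambda>a. 2 * int h - 1 - a" "\<lambda>a. 2 * int h - 1 - a"])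
        (auto simp: v_def)
    also have "\<dots> = (\<Sum>a\<in>v i. \<Sum>b\<in>v j. - g a b)"
    proof (intro sum.cong refl)
      fix a b :: int
      show "g (2 * int h - 1 - a) (2 * int h - 1 - b) = - g a b"
        using g_anti[of a b] by (simp add: g_def)
    qed
    finally show "B (v i) (v j) = - B (v i) (v j)" by (simp add: sum_negf B_def)
  qed
  \<comment> \<open>Unipotent, with ones on the diagonal and just below it; it turns \<open>M\<close> into the matrix of the
    entries \<open>M i j + M (i - 1) j\<close>, with \<open>M (- 1) j = 0\<close> because \<open>G\<close> is even.\<close>
  let ?L = "mat h h (\<lambda>(i, j). if i = j \<or> i = Suc j then 1 else 0 :: int mfps)"
  let ?M = "mat h h (\<lambda>(i, j). G (int i - int j) - G (int i + int j + 2))"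
  have entry: "B (u i) (v (Suc j)) = G (int i - int j - 1) + G (int i - int j) - G (int i + int j + 1) - G (int i + int j + 2)" for i j
  proof -
    have "v (Suc j) = {int h - 1 - int j..int h + int j}" by (auto simp: v_def)
    then show ?thesis
      using sum_telescope2[of G "int h" "int i" j] by (simp add: B_def u_def g_def)
  qed
  have LM: "mat h h (\<lambda>(i, j). B (map u [0..<h] ! i) (map (\<lambda>i. v (Suc i)) [0..<h] ! j)) = ?L * ?M"
  proof (rule eq_matI)
    fix i j assume "i < dim_row (?L * ?M)" "j < dim_col (?L * ?M)"
    then have ij: "i < h" "j < h" by auto
    have "(?L * ?M) $$ (i, j) = (\<Sum>k<h. (if i = k \<or> i = Suc k then 1 else 0) * (G (int k - int j) - G (int k + int j + 2)))"
      using ij by (simp add: scalar_prod_def atLeast0LessThan)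
    also have "\<dots> = (\<Sum>k<h. if i = k \<or> i = Suc k then G (int k - int j) - G (int k + int j + 2) else 0)"
      by (intro sum.cong) auto
    also have "\<dots> = (\<Sum>k\<in>{k. k < h \<and> (i = k \<or> i = Suc k)}. G (int k - int j) - G (int k + int j + 2))"
      by (subst sum.inter_filter[symmetric]) auto
    also have "\<dots> = B (u i) (v (Suc j))"
    proof (cases i)
      case 0
      then have "{k. k < h \<and> (i = k \<or> i = Suc k)} = {0}" using ij by auto
      moreover have "int i - int j - 1 = - (int i + int j + 1)" using 0 by simp
      then have "G (int i - int j - 1) = G (int i + int j + 1)" by (simp only: G)
      ultimately show ?thesis using 0 entry[of i j] by simp
    next
      case (Suc i')
      then have "{k. k < h \<and> (i = k \<or> i = Suc k)} = {i, i'}" using ij by auto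
      then show ?thesis using Suc entry[of i j] by (simp add: algebra_simps)
    qed
    finally show "mat h h (\<lambda>(i, j). B (map u [0..<h] ! i) (map (\<lambda>i. v (Suc i)) [0..<h] ! j)) $$ (i, j) = (?L * ?M) $$ (i, j)"
      using ij by simp
  qed auto
  have "pfaff g h (map int (rev [0..<2 * h])) = pfaff B h (?us @ map w [0..<h])"
    using pfaff_map[of B "\<lambda>a. {a}" h "map int (rev [0..<2 * h])"] initial by (simp add: B_def)
  also have "\<dots> = pfaff B h (?us @ map (\<lambda>i. v (Suc i)) [0..<h])" using replace[of h] by simp
  also have "\<dots> = det (?L * ?M)"
    unfolding LM[symmetric] by (rule pfaff_isotropic_det) (auto simp: isotropic)
  also have "\<dots> = det ?L * det ?M" by (rule det_mult) auto
  also have "det ?L = 1"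
    by (subst det_lower_triangular[of h]) (auto simp: prod_list_diag_prod)
  finally show ?thesis by (simp add: g_def)
qed


section \<open>Particles on a circle\<close>

text \<open>
  Every element of the list stays or moves up by one, with weight \<open>x\<close> for each move.
\<close>

primrec spread :: "'r \<Rightarrow> (int list \<Rightarrow> 'r) \<Rightarrow> int list \<Rightarrow> 'r :: comm_ring_1" where
  "spread x F [] = F []"
| "spread x F (a # as) = spread x (\<lambda>l. F (a # l)) as + x * spread x (\<lambda>l. F ((a + 1) # l)) as"

lemma spread_lin: "spread x (\<lambda>l. c * F l + d * G l) as = c * spread x F as + d * spread x G as"
  by (induction as arbitrary: F G) (simp_all add: algebra_simps)

lemma contract_spread:
  assumes "\<And>b. \<phi>' b = \<phi> b + x * \<phi> (b + 1)"
  shows "contract \<phi>' (spread x F) as = spread x (contract \<phi> F) as"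
proof (induction as arbitrary: F)
  case (Cons a as)
  have "spread x (\<lambda>l. \<phi> b * F l - contract \<phi> (\<lambda>m. F (b # m)) l) as
      = \<phi> b * spread x F as - spread x (contract \<phi> (\<lambda>m. F (b # m))) as" for b
    using spread_lin[of x "\<phi> b" F "- 1" "contract \<phi> (\<lambda>m. F (b # m))" as] by simp
  moreover have "contract \<phi>' (\<lambda>l. spread x (\<lambda>m. F (a # m)) l + x * spread x (\<lambda>m. F ((a + 1) # m)) l) as
      = spread x (contract \<phi> (\<lambda>m. F (a # m))) as + x * spread x (contract \<phi> (\<lambda>m. F ((a + 1) # m))) as"
    by (simp only: contract_add contract_scale Cons.IH)
  ultimately show ?case by (simp add: assms[of a] distrib_right right_diff_distrib mult.assoc)
qed simp

text \<open>
  Each argument occurs exactly once in every term of a Pfaffian, so the choices of the particles to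
  stay or to move can be made inside the kernel.
\<close>

lemma pfaff_spread:
  assumes "\<And>a b. g' a b = g a b + x * g a (b + 1) + x * g (a + 1) b + x * x * g (a + 1) (b + 1)"
  shows "pfaff g' n as = spread x (pfaff g n) as"
proof (induction n arbitrary: as)
  case 0
  have "spread x (\<lambda>l. 0) as = 0" for as
    by (induction as) auto
  then show ?case by (cases as) simp_all
next
  case (Suc n)
  have IH: "pfaff g' n = spread x (pfaff g n)" using Suc.IH by auto
  show ?case
  proof (cases as)
    case (Cons a bs)
    have eq: "g' a = (\<lambda>b. (g a b + x * g a (b + 1)) + x * (g (a + 1) b + x * g (a + 1) (b + 1)))"
      using assms by (auto simp: algebra_simps)
    have "contract (g' a) (spread x (pfaff g n)) bs
       = spread x (contract (g a) (pfaff g n)) bs + x * spread x (contract (g (a + 1)) (pfaff g n)) bs"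
      unfolding eq contract_add_left
      using contract_spread[of "\<lambda>b. g a b + x * g a (b + 1)" "g a" x]
        contract_spread[of "\<lambda>b. g (a + 1) b + x * g (a + 1) (b + 1)" "g (a + 1)" x]
      by (simp add: contract_add_left)
    then show ?thesis using Cons IH by simp
  qed simp
qed

text \<open>
  The adjacency kernel of the circle of circumference \<open>N\<close>, propagated by the variables in \<open>ks\<close>.
\<close>

definition dimer :: "int \<Rightarrow> nat \<Rightarrow> nat list \<Rightarrow> int \<Rightarrow> int \<Rightarrow> int mfps" where
  "dimer s N ks a b = signed_F_in s N ks (a - b - 1) - signed_F_in s N ks (a - b + 1)"

lemma dimer_anti: "dimer s N ks b a = - dimer s N ks a b"
  using signed_F_in_minus[of s N ks "a - b - 1"] signed_F_in_minus[of s N ks "a - b + 1"]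
  by (simp add: dimer_def algebra_simps)

text \<open>
  The kernel depends on \<open>a - b\<close> only: if both particles stay or both move, \<open>a - b\<close> is unchanged, which
  gives \<open>1 + x\<^sup>2\<close>, and otherwise it changes by \<open>\<plusminus>1\<close>.
\<close>

lemma dimer_Cons:
  "dimer s N (k # ks) a b = dimer s N ks a b + var k * dimer s N ks a (b + 1)
     + var k * dimer s N ks (a + 1) b + var k * var k * dimer s N ks (a + 1) (b + 1)"
  by (simp add: dimer_def algebra_simps)

lemma dimer_shift:
  assumes "N > 0" "s * s = 1"
  shows "dimer s N ks (a + int N) b = of_int s * dimer s N ks a b"
  using signed_F_in_shift[OF assms, of ks "a - b - 1"] signed_F_in_shift[OF assms, of ks "a - b + 1"]
  by (simp add: dimer_def algebra_simps)

lemma spread_subsets: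
  assumes "distinct js"
  shows "spread x F (map a js)
    = (\<Sum>S\<in>Pow (set js). x ^ card S * F (map (\<lambda>j. a j + of_bool (j \<in> S)) js))"
  using assms
proof (induction js arbitrary: F)
  case (Cons j js)
  have j: "j \<notin> set js" using Cons.prems by simp
  let ?t = "\<lambda>S. x ^ card S * F (map (\<lambda>j. a j + of_bool (j \<in> S)) (j # js))"
  have disj: "Pow (set js) \<inter> insert j ` Pow (set js) = {}" using j by auto
  have inj: "inj_on (insert j) (Pow (set js))" using j by (auto simp: inj_on_def)
  have "(\<Sum>S\<in>Pow (set (j # js)). ?t S) = (\<Sum>S\<in>Pow (set js). ?t S) + (\<Sum>S\<in>insert j ` Pow (set js). ?t S)"
    using disj by (simp add: Pow_insert sum.union_disjoint)
  also have "(\<Sum>S\<in>insert j ` Pow (set js). ?t S) = (\<Sum>S\<in>Pow (set js). ?t (insert j S))"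
    by (simp add: sum.reindex[OF inj])
  also have "(\<Sum>S\<in>Pow (set js). ?t S)
      = (\<Sum>S\<in>Pow (set js). x ^ card S * F (a j # map (\<lambda>j. a j + of_bool (j \<in> S)) js))"
    using j by (intro sum.cong) auto
  also have "(\<Sum>S\<in>Pow (set js). ?t (insert j S))
      = (\<Sum>S\<in>Pow (set js). x * (x ^ card S * F ((a j + 1) # map (\<lambda>j. a j + of_bool (j \<in> S)) js)))"
  proof (intro sum.cong refl)
    fix S assume "S \<in> Pow (set js)"
    then have "j \<notin> S" "finite S" using j by (auto intro: finite_subset)
    moreover have "map (\<lambda>i. a i + of_bool (i \<in> insert j S)) (j # js) = (a j + 1) # map (\<lambda>j. a j + of_bool (j \<in> S)) js"
      using j by auto
    ultimately show "?t (insert j S) = x * (x ^ card S * F ((a j + 1) # map (\<lambda>j. a j + of_bool (j \<in> S)) js))"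
      by (simp only: card_insert_disjoint power_Suc mult.assoc not_False_eq_True)
  qed
  finally show ?case using Cons by (simp add: sum_distrib_left)
qed simp

text \<open>
  Distinct particles on a circle of circumference \<open>N\<close>, unrolled and listed from a cut; a
  fundamental alcove of the affine symmetric group.
\<close>

definition alcove :: "nat \<Rightarrow> int list \<Rightarrow> bool" where
  "alcove N ps \<longleftrightarrow> sorted_wrt (>) ps \<and> hd ps < last ps + int N"

definition advance :: "int list \<Rightarrow> nat set \<Rightarrow> int list" where
  "advance ps S = map (\<lambda>j. ps ! j + of_bool (j \<in> S)) [0..<length ps]"

lemma length_advance [simp]: "length (advance ps S) = length ps"
  by (simp add: advance_def)

lemma nth_advance [simp]: "j < length ps \<Longrightarrow> advance ps S ! j = ps ! j + of_bool (j \<in> S)"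
  by (simp add: advance_def)

text \<open>
  A step by at most one that leaves the alcove ends on one of its walls: two neighbours coincide, or the first
  particle is exactly \<open>N\<close> ahead of the last.  In the second case the periodicity of the kernel replaces the first
  particle by a copy of the last.
\<close>

lemma pfaff_dimer_wall:
  assumes ps: "alcove N ps" and "length ps \<ge> 2" and N: "N > 0" "s * s = 1"
    and wall: "\<not> alcove N (advance ps S)"
  shows "pfaff (dimer s N ks) h (advance ps S) = 0"
proof (cases "sorted_wrt (>) (advance ps S)")
  case False
  then obtain i where i: "Suc i < length ps" "\<not> advance ps S ! i > advance ps S ! Suc i"
    by (auto simp: sorted_wrt_iff_nth_Suc_transp[OF transp_on_greater])
  have "ps ! i > ps ! Suc i"
    using ps i by (auto simp: alcove_def sorted_wrt_iff_nth_Suc_transp[OF transp_on_greater])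
  then have eq: "advance ps S ! i = advance ps S ! Suc i"
    using i by (cases "i \<in> S"; cases "Suc i \<in> S") auto
  let ?qs = "advance ps S"
  have split: "?qs = take (Suc i) ?qs @ ?qs ! Suc i # drop (Suc (Suc i)) ?qs"
    using i by (intro id_take_nth_drop) simp
  have "?qs ! Suc i \<in> set (take (Suc i) ?qs)"
    using i eq by (auto simp: in_set_conv_nth intro!: exI[of _ i])
  then have "pfaff (dimer s N ks) h (take (Suc i) ?qs @ ?qs ! Suc i # drop (Suc (Suc i)) ?qs) = 0"
    by (intro pfaff_repeat[OF dimer_anti mfps_no_2_torsion])
  then show ?thesis by (simp only: split[symmetric])
next
  case True
  let ?qs = "advance ps S"
  have ne: "ps \<noteq> []" "?qs \<noteq> []" using \<open>length ps \<ge> 2\<close> by (auto simp: advance_def)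
  have "hd ?qs \<ge> last ?qs + int N" using True wall by (simp add: alcove_def)
  moreover have "hd ps < last ps + int N" using ps by (simp add: alcove_def)
  moreover have "hd ?qs \<le> hd ps + 1" "last ?qs \<ge> last ps"
    using ne by (auto simp: hd_conv_nth last_conv_nth)
  ultimately have eq: "hd ?qs = last ?qs + int N" by simp
  obtain p rs l where qs: "?qs = p # rs @ [l]"
    using \<open>length ps \<ge> 2\<close> length_advance[of ps S]
    by (cases ?qs; cases "tl ?qs" rule: rev_cases) auto
  have "pfaff (dimer s N ks) h ([] @ p # rs @ [l])
      = of_int s * pfaff (dimer s N ks) h ([] @ l # rs @ [l]) + 0 * pfaff (dimer s N ks) h ([] @ l # rs @ [l])"
  proof (rule pfaff_additive)
    have p: "p = l + int N" using eq by (simp add: qs)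
    show "dimer s N ks p x = of_int s * dimer s N ks l x + 0 * dimer s N ks l x" for x
      by (simp add: p dimer_shift[OF N])
    then show "dimer s N ks x p = of_int s * dimer s N ks x l + 0 * dimer s N ks x l" for x
      using dimer_anti[of s N ks x p] dimer_anti[of s N ks x l] by simp
  qed
  moreover have "pfaff (dimer s N ks) h ((l # rs) @ l # []) = 0"
    by (rule pfaff_repeat[OF dimer_anti mfps_no_2_torsion]) auto
  ultimately show ?thesis by (simp add: qs)
qed

text \<open>
  A set \<open>R\<close> of pairs describes a motion: \<open>(j, i) \<in> R\<close> means that particle \<open>j\<close> steps at time \<open>i\<close>.
\<close>

definition moved :: "int list \<Rightarrow> (nat \<times> nat) set \<Rightarrow> nat \<Rightarrow> int list" where
  "moved ps R t = map (\<lambda>j. ps ! j + int (card {i. (j, i) \<in> R \<and> i \<le> t})) [0..<length ps]"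

text \<open>
  Sum over the motions during the times \<open>k + 1, \<dots>, k + d\<close> that stay in the alcove, weighted by \<open>c\<close> at
  the final configuration.
\<close>

definition path_sum :: "nat \<Rightarrow> (int list \<Rightarrow> int mfps) \<Rightarrow> nat \<Rightarrow> nat \<Rightarrow> int list \<Rightarrow> int mfps" where
  "path_sum N c k d ps = (\<Sum>R\<in>Pow ({..<length ps} \<times> {k<..k + d}).
     if \<forall>t\<in>{k<..k + d}. alcove N (moved ps R t)
     then c (moved ps R (k + d)) * (\<Prod>(j, i)\<in>R. var i) else 0)"

lemma path_sum_0: "path_sum N c k 0 ps = c ps"
  by (simp add: path_sum_def moved_def map_nth)

lemma sum_Pow_disjoint_Un:
  assumes "X \<inter> Y = {}"
  shows "(\<Sum>R\<in>Pow (X \<union> Y). f R) = (\<Sum>S\<in>Pow X. \<Sum>R\<in>Pow Y. f (S \<union> R))"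
proof -
  have "(\<Sum>R\<in>Pow (X \<union> Y). f R) = (\<Sum>(S, R)\<in>Pow X \<times> Pow Y. f (S \<union> R))"
    by (rule sum.reindex_bij_witness[of _ "\<lambda>(S, R). S \<union> R" "\<lambda>R. (R \<inter> X, R \<inter> Y)"])
      (use assms in \<open>auto simp: Int_Un_distrib[symmetric] intro: arg_cong[of _ _ f]\<close>)
  then show ?thesis by (simp add: sum.cartesian_product)
qed

lemma path_sum_Suc:
  "path_sum N c k (Suc d) ps = (\<Sum>S\<in>Pow {..<length ps}. var (Suc k) ^ card S *
     (if alcove N (advance ps S) then path_sum N c (Suc k) d (advance ps S) else 0))"
proof -
  let ?m = "length ps"
  let ?X = "{..<?m} \<times> {Suc k}" and ?Y = "{..<?m} \<times> {Suc k<..Suc k + d}"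
  let ?f = "\<lambda>R. if \<forall>t\<in>{k<..k + Suc d}. alcove N (moved ps R t)
     then c (moved ps R (k + Suc d)) * (\<Prod>(j, i)\<in>R. var i) else 0"
  let ?g = "\<lambda>S R. if \<forall>t\<in>{Suc k<..Suc k + d}. alcove N (moved (advance ps S) R t)
     then c (moved (advance ps S) R (Suc k + d)) * (\<Prod>(j, i)\<in>R. var i) else 0"
  have XY: "{..<?m} \<times> {k<..k + Suc d} = ?X \<union> ?Y" by auto
  have X: "Pow ?X = (\<lambda>S. S \<times> {Suc k}) ` Pow {..<?m}"
  proof (intro equalityI subsetI)
    fix R assume "R \<in> Pow ?X"
    then have "R = fst ` R \<times> {Suc k}" "fst ` R \<subseteq> {..<?m}" by force+
    then show "R \<in> (\<lambda>S. S \<times> {Suc k}) ` Pow {..<?m}" by blast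
  qed auto
  have inj: "inj_on (\<lambda>S. S \<times> {Suc k}) (Pow {..<?m})" by (auto simp: inj_on_def)
  have "path_sum N c k (Suc d) ps = (\<Sum>S\<in>Pow {..<?m}. \<Sum>R\<in>Pow ?Y. ?f (S \<times> {Suc k} \<union> R))"
    unfolding path_sum_def XY by (subst sum_Pow_disjoint_Un) (auto simp: X sum.reindex[OF inj])
  also have "\<dots> = (\<Sum>S\<in>Pow {..<?m}. \<Sum>R\<in>Pow ?Y.
     var (Suc k) ^ card S * (if alcove N (advance ps S) then ?g S R else 0))"
  proof (intro sum.cong refl)
    fix S R assume S: "S \<in> Pow {..<?m}" and R: "R \<in> Pow ?Y"
    let ?R = "S \<times> {Suc k} \<union> R"
    have finS: "finite S" using S by (auto intro: finite_subset)
    have finR: "finite R" by (rule finite_subset[of _ ?Y]) (use R in auto)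
    have moved: "moved ps ?R t = moved (advance ps S) R t" if "t > k" for t
    proof -
      have "int (card {i. (j, i) \<in> ?R \<and> i \<le> t}) = of_bool (j \<in> S) + int (card {i. (j, i) \<in> R \<and> i \<le> t})" for j
      proof -
        have fin: "finite {i. (j, i) \<in> R \<and> i \<le> t}" by (rule finite_subset[of _ "{..t}"]) auto
        have "Suc k \<notin> {i. (j, i) \<in> R \<and> i \<le> t}" using R by auto
        moreover have "{i. (j, i) \<in> ?R \<and> i \<le> t}
            = (if j \<in> S then insert (Suc k) {i. (j, i) \<in> R \<and> i \<le> t} else {i. (j, i) \<in> R \<and> i \<le> t})"
          using that by auto
        ultimately show ?thesis using fin by simp
      qed
      then show ?thesis by (simp add: moved_def)
    qed
    have start: "moved (advance ps S) R (Suc k) = advance ps S"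
    proof -
      have "{i. (j, i) \<in> R \<and> i \<le> Suc k} = {}" for j using R by auto
      then show ?thesis by (simp add: moved_def advance_def)
    qed
    have "{k<..k + Suc d} = insert (Suc k) {Suc k<..Suc k + d}" by auto
    then have ok: "(\<forall>t\<in>{k<..k + Suc d}. alcove N (moved ps ?R t)) \<longleftrightarrow>
        alcove N (advance ps S) \<and> (\<forall>t\<in>{Suc k<..Suc k + d}. alcove N (moved (advance ps S) R t))"
      using moved start by auto
    have "(\<Prod>(j, i)\<in>?R. var i) = (\<Prod>(j, i)\<in>S \<times> {Suc k}. var i) * (\<Prod>(j, i)\<in>R. var i)"
      using finS finR R by (intro prod.union_disjoint) auto
    also have "(\<Prod>(j, i)\<in>S \<times> {Suc k}. var i) = var (Suc k) ^ card S"
      by (subst prod.cong[OF refl, of _ _ "\<lambda>_. var (Suc k)"]) (auto simp: card_cartesian_product)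
    finally show "?f ?R = var (Suc k) ^ card S * (if alcove N (advance ps S) then ?g S R else 0)"
      unfolding ok using moved[of "k + Suc d"] by (simp add: mult_ac)
  qed
  also have "\<dots> = (\<Sum>S\<in>Pow {..<length ps}. var (Suc k) ^ card S *
     (if alcove N (advance ps S) then path_sum N c (Suc k) d (advance ps S) else 0))"
    by (intro sum.cong refl) (auto simp: path_sum_def sum_distrib_left)
  finally show ?thesis .
qed

text \<open>
  The first step is taken with the restriction to the alcove; the configurations outside contribute
  Pfaffians that vanish, so they may be added, and the unrestricted step only changes the kernel.
\<close>

lemma path_sum_pfaff:
  assumes N: "N > 0" "s * s = 1"
  shows "alcove N ps \<Longrightarrow> length ps \<ge> 2 \<Longrightarrow>
    path_sum N (pfaff (dimer s N []) h) k d ps = pfaff (dimer s N [Suc k..<Suc (k + d)]) h ps"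
proof (induction d arbitrary: k ps)
  case (Suc d)
  let ?ks = "[Suc (Suc k)..<Suc (Suc k + d)]"
  have ks: "[Suc k..<Suc (k + Suc d)] = Suc k # ?ks" by (simp add: upt_conv_Cons del: upt_Suc)
  have "path_sum N (pfaff (dimer s N []) h) k (Suc d) ps
      = (\<Sum>S\<in>Pow {..<length ps}. var (Suc k) ^ card S * pfaff (dimer s N ?ks) h (advance ps S))"
    unfolding path_sum_Suc
  proof (intro sum.cong refl)
    fix S
    show "var (Suc k) ^ card S * (if alcove N (advance ps S)
          then path_sum N (pfaff (dimer s N []) h) (Suc k) d (advance ps S) else 0)
        = var (Suc k) ^ card S * pfaff (dimer s N ?ks) h (advance ps S)"
      using Suc.IH[of "advance ps S" "Suc k"] Suc.prems pfaff_dimer_wall[OF Suc.prems N] by simp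
  qed
  also have "\<dots> = spread (var (Suc k)) (pfaff (dimer s N ?ks) h) (map ((!) ps) [0..<length ps])"
    by (subst spread_subsets) (auto simp: advance_def atLeast0LessThan)
  also have "\<dots> = pfaff (dimer s N (Suc k # ?ks)) h ps"
    unfolding map_nth by (rule pfaff_spread[symmetric]) (rule dimer_Cons)
  finally show ?case unfolding ks .
qed (simp add: path_sum_0)

fun tiled :: "int list \<Rightarrow> bool" where
  "tiled (a # b # ps) \<longleftrightarrow> a = b + 1 \<and> tiled ps"
| "tiled ps \<longleftrightarrow> True"

lemma tiled_iff:
  "length ps = 2 * n \<Longrightarrow> tiled ps \<longleftrightarrow> (\<forall>i<n. ps ! (2 * i) = ps ! (2 * i + 1) + 1)"
proof (induction n arbitrary: ps)
  case (Suc n)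
  then obtain a b qs where "ps = a # b # qs" by (cases ps; cases "tl ps") auto
  then show ?case using Suc by (auto simp: less_Suc_eq_0_disj)
qed simp

text \<open>
  The first case pairs the particles \<open>(1, 2), (3, 4), \<dots>\<close>; the second pairs \<open>(2, 3), (4, 5), \<dots>\<close> and the
  last particle with the first, across the cut.
\<close>

definition tiling_weight :: "int \<Rightarrow> nat \<Rightarrow> int list \<Rightarrow> int" where
  "tiling_weight e N ps = (if tiled ps then 1
     else if hd ps - last ps = int N - 1 \<and> tiled (butlast (tl ps)) then e else 0)"

lemma dimer_initial:
  assumes "0 < a - b" "a - b < int N"
  shows "dimer s N [] a b = of_int (of_bool (a - b = 1) - s * of_bool (a - b = int N - 1))"
proof -
  have "winding_sign s N (a - b - 1) = of_bool (a - b = 1)"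
  proof (cases "a - b = 1")
    case False
    then have "\<not> int N dvd a - b - 1" using assms by (auto dest: zdvd_imp_le)
    then show ?thesis using False by (simp add: winding_sign_def)
  qed (simp add: winding_sign_def)
  moreover have "winding_sign s N (a - b + 1) = s * of_bool (a - b = int N - 1)"
  proof (cases "a - b = int N - 1")
    case True
    then have "a - b + 1 = int N" by simp
    then show ?thesis using True assms by (simp add: winding_sign_def)
  next
    case False
    then have "\<not> int N dvd a - b + 1" using assms by (auto dest: zdvd_imp_le)
    then show ?thesis using False by (simp add: winding_sign_def)
  qed
  ultimately show ?thesis by (simp add: dimer_def)
qed

lemma sorted_greater_last: "sorted_wrt (>) (xs :: int list) \<Longrightarrow> x \<in> set xs \<Longrightarrow> last xs \<le> x"
proof (induction xs)
  case (Cons y xs)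
  then show ?case using last_in_set[of xs] by fastforce
qed simp

text \<open>
  Without a contact across the cut, a particle can only be matched to the next one in the list.
\<close>

lemma pfaff_chain:
  assumes "sorted_wrt (>) ps" "length ps = 2 * n" "ps \<noteq> [] \<Longrightarrow> hd ps - last ps < int N - 1"
  shows "pfaff (dimer s N []) n ps = of_bool (tiled ps)"
  using assms
proof (induction n arbitrary: ps)
  case (Suc n)
  then obtain a b qs where ps: "ps = a # b # qs" by (cases ps; cases "tl ps") auto
  have gap: "a - x < int N - 1" if "x \<in> set (b # qs)" for x
    using Suc.prems sorted_greater_last[of "b # qs" x] that by (auto simp: ps)
  have "contract (dimer s N [] a) (\<lambda>l. pfaff (dimer s N []) n (b # l)) qs = 0"
  proof (rule contract_eq_0, rule disjI1)
    fix ys y zs assume "qs = ys @ y # zs"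
    then have y: "y \<in> set qs" by simp
    then have "a - y \<ge> 2" using Suc.prems(1) by (fastforce simp: ps)
    then show "dimer s N [] a y = 0" using gap[of y] y by (subst dimer_initial) auto
  qed
  moreover have "dimer s N [] a b = of_bool (a = b + 1)"
    using Suc.prems(1) gap[of b] by (subst dimer_initial) (auto simp: ps)
  moreover have "pfaff (dimer s N []) n qs = of_bool (tiled qs)"
  proof (rule Suc.IH)
    show "hd qs - last qs < int N - 1" if "qs \<noteq> []"
    proof -
      have "hd qs < a" using Suc.prems(1) hd_in_set[OF that] by (simp add: ps)
      then show ?thesis using gap[of "last qs"] that by simp
    qed
  qed (use Suc.prems ps in auto)
  ultimately show ?case by (simp add: ps)
qed simp

lemma contract_snoc:
  "contract \<phi> F (xs @ [z]) = contract \<phi> (\<lambda>l. F (l @ [z])) xs + (- 1) ^ length xs * \<phi> z * F xs"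
  by (induction xs arbitrary: F) (simp_all add: algebra_simps)

text \<open>
  The first particle can be matched to the second or, across the cut, to the last one; after that choice the
  others form a chain.  The last particle stands behind an even number of others, so the second choice carries
  only the sign \<open>- s\<close> of the kernel.  Both choices together would force the particles to fill an interval
  of length \<open>2 h\<close> with its ends adjacent, which is impossible for \<open>N > 2 h\<close>.
\<close>

lemma pfaff_initial:
  assumes ps: "alcove N ps" "length ps = 2 * h" and h: "h \<ge> 1" and N: "N > 2 * h"
  shows "pfaff (dimer s N []) h ps = of_int (tiling_weight (- s) N ps)"
proof -
  obtain a qs z where eq: "ps = a # qs @ [z]"
    using ps(2) h by (cases ps; cases "tl ps" rule: rev_cases) auto
  obtain n where n: "h = Suc n" using h by (cases h) auto
  have len: "length qs = 2 * n" using ps(2) by (simp add: eq n)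
  have az: "0 < a - z" "a - z < int N" and sorted: "sorted_wrt (>) (a # qs @ [z])"
    using ps(1) by (auto simp: alcove_def eq sorted_wrt_append)
  have expand: "pfaff (dimer s N []) h ps = contract (dimer s N [] a) (\<lambda>l. pfaff (dimer s N []) n (l @ [z])) qs
      + dimer s N [] a z * pfaff (dimer s N []) n qs"
    by (simp add: eq n contract_snoc len)
  show ?thesis
  proof (cases qs)
    case Nil
    then show ?thesis
      using expand az N len n by (auto simp: eq tiling_weight_def dimer_initial)
  next
    case (Cons b rs)
    then have n1: "n \<ge> 1" using len by (cases n) auto
    have gap: "a - x < int N - 1" if "x \<in> set qs" for x
      using sorted az that by (fastforce simp: sorted_wrt_append)
    have "contract (dimer s N [] a) (\<lambda>l. pfaff (dimer s N []) n (b # l @ [z])) rs = 0"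
    proof (rule contract_eq_0, rule disjI1)
      fix ys y zs assume "rs = ys @ y # zs"
      then have y: "y \<in> set rs" by simp
      then have "a - y \<ge> 2" using sorted by (fastforce simp: Cons)
      then show "dimer s N [] a y = 0" using gap[of y] y by (subst dimer_initial) (auto simp: Cons)
    qed
    moreover have "dimer s N [] a b = of_bool (a = b + 1)"
      using sorted gap[of b] by (subst dimer_initial) (auto simp: Cons)
    moreover have "dimer s N [] a z = - of_int s * of_bool (a - z = int N - 1)"
    proof -
      have "a > b" "b > z" using sorted by (auto simp: Cons)
      then show ?thesis using az by (subst dimer_initial) auto
    qed
    moreover have "pfaff (dimer s N []) n (rs @ [z]) = of_bool (tiled (rs @ [z]))"
    proof (rule pfaff_chain)
      have "hd (rs @ [z]) < b" using sorted by (cases rs) (auto simp: Cons)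
      moreover have "a > b" using sorted by (simp add: Cons)
      ultimately show "hd (rs @ [z]) - last (rs @ [z]) < int N - 1" using az by simp
    qed (use sorted len Cons in auto)
    moreover have "pfaff (dimer s N []) n qs = of_bool (tiled qs)"
    proof (rule pfaff_chain)
      assume qs: "qs \<noteq> []"
      then have "hd qs < a" using sorted hd_in_set[OF qs] by simp
      then show "hd qs - last qs < int N - 1" using gap[OF last_in_set[OF qs]] by simp
    qed (use sorted len in \<open>auto simp: sorted_wrt_append\<close>)
    moreover have "\<not> (tiled ps \<and> tiled qs \<and> a - z = int N - 1)"
    proof
      assume *: "tiled ps \<and> tiled qs \<and> a - z = int N - 1"
      have step: "ps ! i = ps ! Suc i + 1" if "Suc i < 2 * h" for i
      proof (cases "even i")
        case True
        then show ?thesis using * tiled_iff[OF ps(2)] that by (auto elim!: evenE)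
      next
        case False
        then obtain j where j: "i = 2 * j + 1" by (elim oddE)
        then have "j < n" using that n by simp
        then have "qs ! (2 * j) = qs ! (2 * j + 1) + 1" using * tiled_iff[OF len] by auto
        then show ?thesis using j \<open>j < n\<close> len by (simp add: eq nth_append)
      qed
      have "ps ! 0 = ps ! i + int i" if "i < 2 * h" for i
        using that by (induction i) (use step in auto)
      from this[of "2 * h - 1"] have "a = z + int (2 * h - 1)"
        using h len n by (simp add: eq nth_append)
      then show False using * N h by simp
    qed
    ultimately show ?thesis
      using expand by (auto simp: eq tiling_weight_def Cons)
  qed
qed


section \<open>Cylindric tableaux as particle motions\<close>

lemma down_closed_nat:
  assumes "finite (L :: nat set)" "\<And>x y. x \<in> L \<Longrightarrow> y < x \<Longrightarrow> y \<in> L"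
  shows "L = {..<card L}"
proof (cases "L = {}")
  case False
  then have "Max L \<in> L" using assms(1) by simp
  then have "L = {..Max L}" using assms Max_ge[OF assms(1)] by (auto simp: order.order_iff_strict)
  then have "card L = Suc (Max L)" by (metis card_atMost)
  then show ?thesis using \<open>L = {..Max L}\<close> by (simp add: lessThan_Suc_atMost)
qed simp

text \<open>
  An increasing sequence is determined by its rank function: the values \<open>\<le> k\<close> form an initial
  segment.
\<close>

lemma le_iff_rank_less:
  fixes t :: "nat \<Rightarrow> nat"
  assumes t: "strict_mono_on {..<n} t" and l: "l < n"
  shows "t l \<le> k \<longleftrightarrow> l < card {i \<in> t ` {..<n}. i \<le> k}"
proof -
  let ?L = "{l. l < n \<and> t l \<le> k}"
  have "inj_on t ?L" by (rule inj_on_subset[OF strict_mono_on_imp_inj_on[OF t]]) auto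
  moreover have "{i \<in> t ` {..<n}. i \<le> k} = t ` ?L" by auto
  ultimately have card: "card {i \<in> t ` {..<n}. i \<le> k} = card ?L" by (simp add: card_image)
  have "?L = {..<card ?L}"
    by (rule down_closed_nat) (use strict_mono_onD[OF t] in \<open>force+\<close>)
  then show ?thesis using l unfolding card by (metis (mono_tags, lifting) lessThan_iff mem_Collect_eq)
qed

lemma strict_mono_on_Suc:
  fixes t :: "nat \<Rightarrow> nat"
  assumes "\<And>l. Suc l < n \<Longrightarrow> t l < t (Suc l)"
  shows "strict_mono_on {..<n} t"
proof (rule strict_mono_onI)
  fix r s assume "r \<in> {..<n}" "s \<in> {..<n}" "r < s"
  then show "t r < t s"
  proof (induction s)
    case (Suc s)
    then have "t s < t (Suc s)" by (intro assms) auto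
    then show ?case using Suc by (cases "r = s") auto
  qed simp
qed

text \<open>
  The distance that particle \<open>j\<close> has moved up to time \<open>t\<close>.
\<close>

definition rank :: "(nat \<times> nat) set \<Rightarrow> nat \<Rightarrow> nat \<Rightarrow> nat" where
  "rank R t j = card {i. (j, i) \<in> R \<and> i \<le> t}"

text \<open>
  The collision-free condition at time \<open>t\<close> for particles that start at \<open>m - 1, \<dots>, 0\<close>; equivalently,
  the distances moved form a partition in \<open>Par m w\<close>.
\<close>

definition interlacing :: "nat \<Rightarrow> nat \<Rightarrow> (nat \<times> nat) set \<Rightarrow> nat \<Rightarrow> bool" where
  "interlacing m w R t \<longleftrightarrow>
     (\<forall>j. Suc j < m \<longrightarrow> rank R t (Suc j) \<le> rank R t j) \<and> rank R t 0 \<le> rank R t (m - 1) + w"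

locale cylindric =
  fixes lam :: "nat list" and m w :: nat
  assumes lam: "lam \<in> Par m w" and m: "m > 0" and w: "w > 0"
begin

abbreviation mu :: "nat list" where "mu \<equiv> cyl_transpose lam m w"

definition row :: "nat \<Rightarrow> nat" where "row j = part lam (Suc j)"

text \<open>
  The cell of the transposed shape that corresponds to the cell in row \<open>j\<close> and column \<open>l\<close> of \<open>\<lambda>\<close>, both
  counted from \<open>0\<close>: the transposed cell \<open>(l + 1, j + 1)\<close> is translated by a multiple of \<open>(- w, m)\<close> into the rows \<open>1, \<dots>, w\<close>.
\<close>

definition cell :: "nat \<Rightarrow> nat \<Rightarrow> cell" where
  "cell j l = (int (l mod w) + 1, int (j + m * (l div w)) + 1)"

lemma mu: "is_partition mu"
  "(i, c) \<in> young mu \<longleftrightarrow> 1 \<le> i \<and> i \<le> int w \<and> (\<exists>k. (c - k * int m, i + k * int w) \<in> young lam)"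
proof -
  have *: "is_partition mu \<and> young mu = {(i, j) \<in> prod.swap ` cyl_shape lam m w. 1 \<le> i \<and> i \<le> int w}"
    unfolding cyl_transpose_def by (rule theI'[OF cyl_transpose_ex1[OF lam m w]])
  then show "is_partition mu" by simp
  have "(i, c) \<in> prod.swap ` cyl_shape lam m w \<longleftrightarrow> (c, i) \<in> cyl_shape lam m w" by force
  then show "(i, c) \<in> young mu \<longleftrightarrow> 1 \<le> i \<and> i \<le> int w \<and> (\<exists>k. (c - k * int m, i + k * int w) \<in> young lam)"
    using * by (auto simp: cyl_shape_def mem_shift)
qed

lemma row_antimono: "row (Suc j) \<le> row j"
  using lam unfolding row_def Par_def by (intro part_antimono) auto

lemma row_wrap: "row 0 \<le> row (m - 1) + w"
  using lam m by (simp add: row_def Par_def)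

lemma cell_inj:
  assumes "j < m" "j' < m" "cell j l = cell j' l'"
  shows "j = j' \<and> l = l'"
proof -
  have *: "l mod w = l' mod w" "j + m * (l div w) = j' + m * (l' div w)"
    using assms(3) by (auto simp: cell_def simp flip: of_nat_add of_nat_mult)
  have "(j + m * (l div w)) mod m = (j' + m * (l' div w)) mod m"
    "(j + m * (l div w)) div m = (j' + m * (l' div w)) div m" using *(2) by simp_all
  then have "j = j'" "l div w = l' div w" using assms(1,2) by simp_all
  then show ?thesis using *(1) by (metis div_mult_mod_eq)
qed

text \<open>
  Since \<open>\<lambda>\<close> has at most \<open>m\<close> rows, only one translate can bring a given cell into it.
\<close>

lemma cell_mem_iff:
  assumes "j < m"
  shows "cell j l \<in> young mu \<longleftrightarrow> l < row j"
proof
  let ?q = "l div w"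
  assume "cell j l \<in> young mu"
  then obtain k where "(int (j + m * ?q) + 1 - k * int m, int (l mod w) + 1 + k * int w) \<in> young lam"
    unfolding cell_def mu by auto
  then have k: "1 \<le> int (j + m * ?q) + 1 - k * int m"
      "int (l mod w) + 1 + k * int w \<le> int (part lam (nat (int (j + m * ?q) + 1 - k * int m)))"
      "1 \<le> int (l mod w) + 1 + k * int w"
    unfolding young_def by auto
  have "int (j + m * ?q) + 1 - k * int m \<le> int m"
  proof (rule ccontr)
    assume "\<not> ?thesis"
    then have "part lam (nat (int (j + m * ?q) + 1 - k * int m)) = 0"
      using lam by (auto simp: part_def Par_def)
    then show False using k by simp
  qed
  then have "0 \<le> int j + int m * (int ?q - k)" "int j + int m * (int ?q - k) < int m"
    using k(1) by (simp_all add: algebra_simps)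
  moreover have "int j < int m" using assms by simp
  ultimately have "int m * (int ?q - k) > int m * (- 1)" "int m * (int ?q - k) < int m * 1" by linarith+
  then have "int ?q - k > - 1" "int ?q - k < 1" using m by (simp_all only: mult_less_cancel_left_pos of_nat_0_less_iff)
  then have "k = int ?q" by simp
  then have "int (l mod w) + 1 + int ?q * int w \<le> int (row j)"
    using k(2) by (simp add: row_def nat_add_distrib algebra_simps)
  also have "int (l mod w) + 1 + int ?q * int w = int l + 1"
    using mod_mult_div_eq[of l w] by (metis add.assoc add.commute mult.commute of_nat_add of_nat_mult)
  finally show "l < row j" by simp
next
  assume l: "l < row j"
  have "int (l mod w) + 1 + int (l div w) * int w = int l + 1"
    using mod_mult_div_eq[of l w] by (metis add.assoc add.commute mult.commute of_nat_add of_nat_mult)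
  then have "(int (j + m * (l div w)) + 1 - int (l div w) * int m, int (l mod w) + 1 + int (l div w) * int w) \<in> young lam"
    using l by (simp add: young_def row_def nat_add_distrib)
  moreover have "l mod w < w" using w by simp
  then have "int (l mod w) + 1 \<le> int w" by linarith
  moreover have "1 \<le> int (l mod w) + 1" by simp
  ultimately show "cell j l \<in> young mu" unfolding cell_def mu by blast
qed

lemma cell_cases:
  assumes "(i, c) \<in> young mu"
  obtains j l where "j < m" "l < row j" "(i, c) = cell j l"
proof -
  have ic: "1 \<le> i" "i \<le> int w" "1 \<le> c" using assms mu(2) by (auto simp: young_def)
  define j where "j = nat (c - 1) mod m"
  define q where "q = nat (c - 1) div m"
  define l where "l = nat (i - 1) + w * q"
  have "nat (i - 1) < w" using ic by simp
  then have "l mod w = nat (i - 1)" "l div w = q" by (simp_all add: l_def)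
  moreover have "j + m * q = nat (c - 1)" by (simp add: j_def q_def)
  ultimately have "(i, c) = cell j l" using ic by (simp add: cell_def)
  moreover have "j < m" using m by (simp add: j_def)
  ultimately show ?thesis using that assms cell_mem_iff by metis
qed

lemma cell_right:
  "cell (Suc j) l = (fst (cell j l), snd (cell j l) + 1)"
  "cell 0 (l + w) = (fst (cell (m - 1) l), snd (cell (m - 1) l) + 1)"
  using m w by (simp_all add: cell_def of_nat_diff algebra_simps)

lemma cell_down:
  "Suc (l mod w) < w \<Longrightarrow> cell j (Suc l) = (fst (cell j l) + 1, snd (cell j l))"
  "Suc (l mod w) = w \<Longrightarrow> fst (cell j l) = int w \<and> cell j (Suc l) = (1, snd (cell j l) + int m)"
  by (simp_all add: cell_def mod_Suc div_Suc algebra_simps)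

lemma cell_lessD:
  assumes "j < m" "j' < m" "cell j l = (i, c)" "cell j' l' = (i', c)" "i < i'"
  shows "j = j' \<and> l < l'"
proof -
  have *: "l mod w < l' mod w" "j + m * (l div w) = j' + m * (l' div w)"
    using assms(3-) by (auto simp: cell_def simp flip: of_nat_add of_nat_mult)
  have "(j + m * (l div w)) mod m = (j' + m * (l' div w)) mod m"
    "(j + m * (l div w)) div m = (j' + m * (l' div w)) div m" using *(2) by simp_all
  then have "j = j'" "l div w = l' div w" using assms(1,2) by simp_all
  then show ?thesis using *(1) by (metis div_mult_mod_eq nat_add_left_cancel_less)
qed

lemma cell_wrap_lessD:
  assumes "j < m" "j' < m" "cell j l = (i, c)" "cell j' l' = (i', c + int m)"
  shows "j = j' \<and> l < l'"
proof -
  have "j + m * (l div w) + m = j' + m * (l' div w)"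
    using assms(3-) by (auto simp: cell_def simp flip: of_nat_add of_nat_mult)
  then have *: "j + m * Suc (l div w) = j' + m * (l' div w)" by simp
  have "(j + m * Suc (l div w)) mod m = (j' + m * (l' div w)) mod m"
    "(j + m * Suc (l div w)) div m = (j' + m * (l' div w)) div m" using * by simp_all
  then have "j = j'" "Suc (l div w) = l' div w" using assms(1,2) by (simp_all del: mult_Suc_right)
  then have "l div w < l' div w" by simp
  then have "l < l'" using div_le_mono[of l' l w] by linarith
  then show ?thesis using \<open>j = j'\<close> by simp
qed

text \<open>
  Shifted to the right by \<open>m\<close>, the two copies together with a \<open>w \<times> m\<close> rectangle on the left of the upper copy
  form a Young diagram.  The only step that is not clear from the single copies is the one from the lower to
  the upper copy: \<open>\<mu>\<^sub>1 \<le> \<mu>\<^sub>w + m\<close>.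
\<close>

lemma double_skew: "is_skew_shape (young mu \<union> shift (int w) (- int m) (young mu))"
proof -
  have pos: "1 \<le> i \<and> i \<le> int w \<and> 1 \<le> c" if "(i, c) \<in> young mu" for i c
    using that mu(2)[of i c] by (auto simp: young_def)
  note down = young_down[OF mu(1)]
  \<comment> \<open>The cell above \<open>(1, c)\<close> in the periodic shape.\<close>
  have wrap: "(int w, c - int m) \<in> young mu" if c: "(1, c) \<in> young mu" "c > int m" for c
  proof -
    obtain j l where jl: "j < m" "l < row j" "(1, c) = cell j l" using cell_cases[OF c(1)] by metis
    have l: "l mod w = 0" "c = int (j + m * (l div w)) + 1" using jl(3) by (auto simp: cell_def)
    have "l div w \<noteq> 0"
    proof
      assume "l div w = 0"
      then have "c = int j + 1" using l(2) by simp
      then show False using c(2) jl(1) by simp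
    qed
    then obtain l' where l': "l = Suc l'" by (cases l) auto
    have w': "Suc (l' mod w) = w" using l(1) unfolding l' by (auto simp: mod_Suc split: if_splits)
    then have "cell j l' = (int w, c - int m)"
      using cell_down(2)[OF w', of j] jl(3) by (cases "cell j l'") (simp add: l')
    then show ?thesis using cell_mem_iff[OF jl(1), of l'] jl(2) l' by simp
  qed
  define S where "S = {(i, c). 1 \<le> i \<and> 1 \<le> c \<and>
    ((i \<le> int w \<and> (c \<le> int m \<or> (i, c - int m) \<in> young mu)) \<or> (i - int w, c) \<in> young mu)}"
  have "\<exists>alpha. is_partition alpha \<and> young alpha = S"
  proof (rule down_closed_young)
    have "S \<subseteq> {1..int w} \<times> {1..int m} \<union> (\<lambda>(i, c). (i, c + int m)) ` young mu
        \<union> (\<lambda>(i, c). (i + int w, c)) ` young mu"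
    proof
      fix x assume "x \<in> S"
      then obtain i c where x: "x = (i, c)" "1 \<le> i" "1 \<le> c"
        and "(i \<le> int w \<and> c \<le> int m) \<or> (i, c - int m) \<in> young mu \<or> (i - int w, c) \<in> young mu"
        by (auto simp: S_def)
      then show "x \<in> {1..int w} \<times> {1..int m} \<union> (\<lambda>(i, c). (i, c + int m)) ` young mu
        \<union> (\<lambda>(i, c). (i + int w, c)) ` young mu"
        by (elim disjE) (auto intro: image_eqI[of _ _ "(i, c - int m)"] image_eqI[of _ _ "(i - int w, c)"])
    qed
    then show "finite S" by (rule finite_subset) (simp add: finite_young)
    show "1 \<le> i \<and> 1 \<le> j" if "(i, j) \<in> S" for i j using that by (simp add: S_def)
    fix i j i' j' assume S: "(i, j) \<in> S" and le: "1 \<le> i'" "i' \<le> i" "1 \<le> j'" "j' \<le> j"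
    show "(i', j') \<in> S"
    proof (cases "(i - int w, j) \<in> young mu")
      case True
      show ?thesis
      proof (cases "i' \<le> int w")
        case i': True
        have "(i', j' - int m) \<in> young mu" if "j' > int m"
        proof -
          have "(1, j') \<in> young mu" using down[OF True, of 1 j'] pos[OF True] le by simp
          then have "(int w, j' - int m) \<in> young mu" using wrap that by simp
          then show ?thesis using down[of "int w" "j' - int m" i' "j' - int m"] i' le that by simp
        qed
        then show ?thesis using le i' by (auto simp: S_def)
      next
        case False
        then show ?thesis using down[OF True, of "i' - int w" j'] le by (simp add: S_def)
      qed
    next
      case False
      then have "i \<le> int w" "j \<le> int m \<or> (i, j - int m) \<in> young mu" using S by (auto simp: S_def)
      moreover have "(i', j' - int m) \<in> young mu" if "(i, j - int m) \<in> young mu" "j' > int m"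
        using down[OF that(1), of i' "j' - int m"] le that by simp
      ultimately show ?thesis using le by (auto simp: S_def)
    qed
  qed
  then obtain alpha where alpha: "is_partition alpha" "young alpha = S" by auto
  let ?beta = "replicate w m"
  have beta: "is_partition ?beta" using m by (simp add: is_partition_def sorted_wrt_iff_nth_less)
  have "part ?beta (nat i) = (if 1 \<le> i \<and> i \<le> int w then m else 0)" for i
    by (auto simp: part_def)
  then have young_beta: "young ?beta = {(i, c). 1 \<le> i \<and> i \<le> int w \<and> 1 \<le> c \<and> c \<le> int m}"
    by (auto simp: young_def split: if_splits)
  have "young mu \<union> shift (int w) (- int m) (young mu) = shift 0 (- int m) (young alpha - young ?beta)"
  proof (rule Set.set_eqI)
    fix x :: cell
    obtain i c where x: "x = (i, c)" by fastforce
    have "(i, c) \<in> shift 0 (- int m) (young alpha - young ?beta)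
        \<longleftrightarrow> (i, c + int m) \<in> S \<and> \<not> (i \<le> int w \<and> c \<le> 0)"
      by (auto simp: mem_shift alpha young_beta S_def)
    also have "\<dots> \<longleftrightarrow> (i, c) \<in> young mu \<or> (i - int w, c + int m) \<in> young mu"
    proof -
      have "i \<le> int w \<and> 1 \<le> i \<and> 1 \<le> c" if "(i, c) \<in> young mu" using pos[OF that] by simp
      moreover have "i > int w \<and> 1 \<le> c + int m" if "(i - int w, c + int m) \<in> young mu" using pos[OF that] by simp
      ultimately show ?thesis unfolding S_def by auto
    qed
    finally show "x \<in> young mu \<union> shift (int w) (- int m) (young mu)
        \<longleftrightarrow> x \<in> shift 0 (- int m) (young alpha - young ?beta)"
      by (simp add: mem_shift x)
  qed
  moreover have "young ?beta \<subseteq> young alpha" by (auto simp: young_beta alpha S_def)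
  ultimately show ?thesis using alpha(1) beta unfolding is_skew_shape_def by blast
qed

text \<open>
  In terms of \<open>\<lambda>\<close>, a cylindric semistandard tableau of the transposed shape is a cylindric row-strict
  tableau.  Neighbouring cells of the doubled diagram are neighbours in \<open>\<lambda>\<close>, where the last row is followed by the first one
  shifted by \<open>w\<close>; the inequalities between all cells of a row or column follow from these.
\<close>

lemma CSSYT_iff:
  "T \<in> CSSYT mu w m \<longleftrightarrow> T \<in> young mu \<rightarrow>\<^sub>E {1..} \<and>
     (\<forall>j<m. strict_mono_on {..<row j} (\<lambda>l. T (cell j l))) \<and>
     (\<forall>j l. Suc j < m \<and> l < row (Suc j) \<longrightarrow> T (cell j l) \<le> T (cell (Suc j) l)) \<and>
     (\<forall>l. l + w < row 0 \<longrightarrow> T (cell (m - 1) l) \<le> T (cell 0 (l + w)))"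
    (is "_ \<longleftrightarrow> ?PiE \<and> ?strict \<and> ?weak \<and> ?wrap")
proof -
  let ?D = "young mu \<union> shift (int w) (- int m) (young mu)"
  let ?dbl = "cyl_double w m (young mu) T"
  have pos: "1 \<le> i \<and> i \<le> int w" if "(i, c) \<in> young mu" for i c
    using that mu(2)[of i c] by auto
  have D: "(i, c) \<in> ?D \<longleftrightarrow> (i, c) \<in> young mu \<or> (i - int w, c + int m) \<in> young mu" for i c
    by (simp add: mem_shift)
  have "(i, c) \<notin> young mu" if "(i - int w, c + int m) \<in> young mu" for i c
    using pos[OF that] pos[of i c] by auto
  then have dbl: "(i, c) \<in> young mu \<Longrightarrow> ?dbl (i, c) = T (i, c)"
    "(i - int w, c + int m) \<in> young mu \<Longrightarrow> ?dbl (i, c) = T (i - int w, c + int m)" for i c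
    by (simp_all add: cyl_double_def)
  have mem: "T \<in> CSSYT mu w m \<longleftrightarrow> is_SSYT (young mu) T \<and> is_SSYT ?D ?dbl"
    using double_skew by (simp add: CSSYT_def Let_def)
  show ?thesis
  proof
    assume "T \<in> CSSYT mu w m"
    then have T: "is_SSYT (young mu) T" "is_SSYT ?D ?dbl" using mem by auto
    have ?PiE using T(1) by (simp add: is_SSYT_def)
    have row: "T (i, c) \<le> T (i, c + 1)" if "(i, c) \<in> young mu" "(i, c + 1) \<in> young mu" for i c
      using T(1) that unfolding is_SSYT_def by (metis less_add_one)
    have ?strict
    proof (intro allI impI strict_mono_on_Suc)
      fix j l assume j: "j < m" and l: "Suc l < row j"
      have in_mu: "cell j l \<in> young mu" "cell j (Suc l) \<in> young mu"
        using cell_mem_iff[OF j] l by auto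
      obtain i c where ic: "cell j l = (i, c)" by fastforce
      show "T (cell j l) < T (cell j (Suc l))"
      proof (cases "Suc (l mod w) < w")
        case True
        then have "cell j (Suc l) = (i + 1, c)" using cell_down(1) ic by simp
        then show ?thesis using T(1) in_mu ic unfolding is_SSYT_def by (metis less_add_one)
      next
        case False
        then have "Suc (l mod w) = w" using w mod_less_divisor[of w l] by linarith
        then have "i = int w" and next_cell: "cell j (Suc l) = (1, c + int m)"
          using cell_down(2)[of l j] ic by auto
        then have "(i, c) \<in> young mu" "(i + 1 - int w, c + int m) \<in> young mu" using in_mu ic by auto
        then have "?dbl (i, c) = T (i, c)" "?dbl (i + 1, c) = T (i + 1 - int w, c + int m)"
          "(i, c) \<in> ?D" "(i + 1, c) \<in> ?D" by (simp_all only: dbl D simp_thms)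
        then have "T (i, c) < T (i + 1 - int w, c + int m)"
          using T(2) unfolding is_SSYT_def by (metis less_add_one)
        then show ?thesis using ic next_cell \<open>i = int w\<close> by simp
      qed
    qed
    moreover have ?weak
    proof (intro allI impI, elim conjE)
      fix j l assume jl: "Suc j < m" "l < row (Suc j)"
      then have "cell j l \<in> young mu" "cell (Suc j) l \<in> young mu"
        using cell_mem_iff row_antimono[of j] by auto
      then show "T (cell j l) \<le> T (cell (Suc j) l)"
        unfolding cell_right(1) using row by (metis prod.collapse)
    qed
    moreover have ?wrap
    proof (intro allI impI)
      fix l assume l: "l + w < row 0"
      then have "cell (m - 1) l \<in> young mu" "cell 0 (l + w) \<in> young mu"
        using cell_mem_iff row_wrap m by auto
      then show "T (cell (m - 1) l) \<le> T (cell 0 (l + w))"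
        unfolding cell_right(2) using row by (metis prod.collapse)
    qed
    ultimately show "?PiE \<and> ?strict \<and> ?weak \<and> ?wrap" using \<open>?PiE\<close> by blast
  next
    assume *: "?PiE \<and> ?strict \<and> ?weak \<and> ?wrap"
    have strictD: "T (cell j l) < T (cell j l')" if "j < m" "l < l'" "l' < row j" for j l l'
      using * that strict_mono_onD[of "{..<row j}" "\<lambda>l. T (cell j l)" l l'] by simp
    have step: "T (i, c) \<le> T (i, c + 1)" if in_mu: "(i, c) \<in> young mu" "(i, c + 1) \<in> young mu" for i c
    proof -
      obtain j l where jl: "j < m" "l < row j" "(i, c) = cell j l" using cell_cases[OF in_mu(1)] by metis
      show ?thesis
      proof (cases "Suc j < m")
        case True
        then have "cell (Suc j) l = (i, c + 1)" using cell_right(1) jl(3) by (metis fst_conv snd_conv)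
        then show ?thesis using * in_mu(2) cell_mem_iff[OF True, of l] True jl(3) by metis
      next
        case False
        then have "j = m - 1" using jl(1) by simp
        then have "cell 0 (l + w) = (i, c + 1)" using cell_right(2) jl(3) by (metis fst_conv snd_conv)
        then show ?thesis using * in_mu(2) cell_mem_iff[OF m, of "l + w"] \<open>j = m - 1\<close> jl(3) by metis
      qed
    qed
    have steps: "T (i, c) \<le> T (i, c + int d)" if "(i, c) \<in> young mu" "(i, c + int d) \<in> young mu" for i c d
      using that(2)
    proof (induction d)
      case (Suc d)
      have "(i, c + int d) \<in> young mu"
        by (rule young_down[OF mu(1) Suc.prems]) (use that(1) in \<open>auto simp: young_def\<close>)
      moreover have "c + int (Suc d) = c + int d + 1" by simp
      ultimately show ?case using Suc step[of i "c + int d"] by (metis order_trans)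
    qed simp
    have rows: "T (i, c) \<le> T (i, c')" if "(i, c) \<in> young mu" "(i, c') \<in> young mu" "c < c'" for i c c'
      using steps[of i c "nat (c' - c)"] that by simp
    have cols: "T (i, c) < T (i', c)" if in_mu: "(i, c) \<in> young mu" "(i', c) \<in> young mu" and "i < i'" for i i' c
    proof -
      obtain j l where jl: "j < m" "l < row j" "(i, c) = cell j l" using cell_cases[OF in_mu(1)] by metis
      obtain j' l' where jl': "j' < m" "l' < row j'" "(i', c) = cell j' l'" using cell_cases[OF in_mu(2)] by metis
      have "j = j' \<and> l < l'" using cell_lessD[OF jl(1) jl'(1)] jl(3) jl'(3) \<open>i < i'\<close> by metis
      then show ?thesis using strictD[of j l l'] jl jl' by simp
    qed
    have wrap_cols: "T (i, c) < T (i', c + int m)" if in_mu: "(i, c) \<in> young mu" "(i', c + int m) \<in> young mu" for i i' c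
    proof -
      obtain j l where jl: "j < m" "l < row j" "(i, c) = cell j l" using cell_cases[OF in_mu(1)] by metis
      obtain j' l' where jl': "j' < m" "l' < row j'" "(i', c + int m) = cell j' l'" using cell_cases[OF in_mu(2)] by metis
      have "j = j' \<and> l < l'" using cell_wrap_lessD[OF jl(1) jl'(1)] jl(3) jl'(3) by metis
      then show ?thesis using strictD[of j l l'] jl jl' by simp
    qed
    have "is_SSYT (young mu) T" using * rows cols unfolding is_SSYT_def by blast
    moreover have "is_SSYT ?D ?dbl"
      unfolding is_SSYT_def
    proof (intro conjI allI impI)
      have "?dbl x \<in> {1..}" if "x \<in> ?D" for x
      proof (cases x)
        case (Pair i c)
        then show ?thesis using that * D[of i c] dbl[where i = i and c = c] by (auto simp: PiE_iff)
      qed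
      moreover have "?dbl x = undefined" if "x \<notin> ?D" for x
        using that by (cases x) (simp add: cyl_double_def mem_shift)
      ultimately show "?dbl \<in> ?D \<rightarrow>\<^sub>E {1..}" by blast
    next
      fix i c c' assume "(i, c) \<in> ?D \<and> (i, c') \<in> ?D \<and> c < c'"
      then consider "(i, c) \<in> young mu" "(i, c') \<in> young mu" "c < c'"
        | "(i - int w, c + int m) \<in> young mu" "(i - int w, c' + int m) \<in> young mu" "c < c'"
        unfolding D using pos[of i c] pos[of i c'] pos[of "i - int w" "c + int m"] pos[of "i - int w" "c' + int m"]
        by auto
      then show "?dbl (i, c) \<le> ?dbl (i, c')" by cases (auto simp: dbl intro: rows)
    next
      fix i i' c assume "(i, c) \<in> ?D \<and> (i', c) \<in> ?D \<and> i < i'"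
      then consider "(i, c) \<in> young mu" "(i', c) \<in> young mu" "i < i'"
        | "(i - int w, c + int m) \<in> young mu" "(i' - int w, c + int m) \<in> young mu" "i < i'"
        | "(i, c) \<in> young mu" "(i' - int w, c + int m) \<in> young mu"
        unfolding D using pos[of i' c] pos[of "i - int w" "c + int m"] by auto
      then show "?dbl (i, c) < ?dbl (i', c)" by cases (auto simp: dbl intro: cols wrap_cols)
    qed
    ultimately show "T \<in> CSSYT mu w m" using mem by simp
  qed
qed

definition entries :: "(cell \<Rightarrow> nat) \<Rightarrow> (nat \<times> nat) set" where
  "entries T = {(j, T (cell j l)) | j l. j < m \<and> l < row j}"

text \<open>
  A strictly increasing row is the same as the set of its entries, so a row-strict tableau is a relation
  between rows and entries.
\<close>

definition row_relations :: "(nat \<times> nat) set set" where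
  "row_relations = {R. R \<subseteq> {..<m} \<times> {1..} \<and> finite R \<and> (\<forall>j<m. card (R `` {j}) = row j) \<and>
     (\<forall>t. interlacing m w R t)}"

lemma entries_row: "j < m \<Longrightarrow> entries T `` {j} = (\<lambda>l. T (cell j l)) ` {..<row j}"
  by (auto simp: entries_def)

lemma finite_entries: "finite (entries T)"
proof -
  have "entries T \<subseteq> (\<lambda>(j, l). (j, T (cell j l))) ` (SIGMA j:{..<m}. {..<row j})"
    by (auto simp: entries_def)
  then show ?thesis by (rule finite_subset) simp
qed

text \<open>
  An entrywise comparison of two increasing rows, offset by \<open>d\<close>, is the opposite comparison of
  their rank functions.
\<close>

lemma interlace_iff:
  assumes "j < m" "j' < m" "row j' \<le> row j + d"
    and str: "strict_mono_on {..<row j} (\<lambda>l. T (cell j l))" "strict_mono_on {..<row j'} (\<lambda>l. T (cell j' l))"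
    and R: "R `` {j} = (\<lambda>l. T (cell j l)) ` {..<row j}" "R `` {j'} = (\<lambda>l. T (cell j' l)) ` {..<row j'}"
  shows "(\<forall>l. l + d < row j' \<longrightarrow> T (cell j l) \<le> T (cell j' (l + d))) \<longleftrightarrow> (\<forall>t. rank R t j' \<le> rank R t j + d)"
proof -
  have rank: "rank R t i = card {x \<in> R `` {i}. x \<le> t}" for t i by (simp add: rank_def Image_singleton)
  have le: "T (cell j l) \<le> t \<longleftrightarrow> l < rank R t j" if "l < row j" for l t
    using le_iff_rank_less[OF str(1) that] by (simp add: rank R)
  have le': "T (cell j' l) \<le> t \<longleftrightarrow> l < rank R t j'" if "l < row j'" for l t
    using le_iff_rank_less[OF str(2) that] by (simp add: rank R)
  have bound: "rank R t j' \<le> row j'" for t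
  proof -
    have "rank R t j' \<le> card ((\<lambda>l. T (cell j' l)) ` {..<row j'})"
      unfolding rank R by (rule card_mono) auto
    then show ?thesis using card_image_le[of "{..<row j'}" "\<lambda>l. T (cell j' l)"] by simp
  qed
  show ?thesis
  proof (intro iffI allI impI)
    fix t assume *: "\<forall>l. l + d < row j' \<longrightarrow> T (cell j l) \<le> T (cell j' (l + d))"
    show "rank R t j' \<le> rank R t j + d"
    proof (rule ccontr)
      define l where "l = rank R t j"
      assume "\<not> ?thesis"
      then have l: "l + d < rank R t j'" by (simp add: l_def)
      then have "l + d < row j'" using bound[of t] by simp
      then have "T (cell j l) \<le> T (cell j' (l + d))" "T (cell j' (l + d)) \<le> t"
        using * le' l by auto
      then have "T (cell j l) \<le> t" by simp
      then show False using le[of l t] \<open>l + d < row j'\<close> assms(3) by (simp add: l_def)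
    qed
  next
    fix l assume *: "\<forall>t. rank R t j' \<le> rank R t j + d" and l: "l + d < row j'"
    have "l + d < rank R (T (cell j' (l + d))) j'" using le'[OF l, of "T (cell j' (l + d))"] by simp
    then have "l < rank R (T (cell j' (l + d))) j" using * by (metis add_less_cancel_right order_less_le_trans)
    then show "T (cell j l) \<le> T (cell j' (l + d))" using le[of l] l assms(3) by simp
  qed
qed

lemma CSSYT_iff_relation:
  assumes T: "T \<in> young mu \<rightarrow>\<^sub>E UNIV" and str: "\<And>j. j < m \<Longrightarrow> strict_mono_on {..<row j} (\<lambda>l. T (cell j l))"
  shows "T \<in> CSSYT mu w m \<longleftrightarrow> entries T \<in> row_relations"
proof -
  have "T \<in> young mu \<rightarrow>\<^sub>E {1..} \<longleftrightarrow> (\<forall>j l. j < m \<and> l < row j \<longrightarrow> T (cell j l) \<ge> 1)"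
  proof
    assume "T \<in> young mu \<rightarrow>\<^sub>E {1..}"
    then show "\<forall>j l. j < m \<and> l < row j \<longrightarrow> T (cell j l) \<ge> 1" using cell_mem_iff by fastforce
  next
    assume *: "\<forall>j l. j < m \<and> l < row j \<longrightarrow> T (cell j l) \<ge> 1"
    have "T c \<in> {1..}" if c: "c \<in> young mu" for c
    proof -
      obtain i c' where "c = (i, c')" by fastforce
      then show ?thesis using cell_cases[of i c'] * c by (metis atLeast_iff)
    qed
    then show "T \<in> young mu \<rightarrow>\<^sub>E {1..}" using T by (auto simp: PiE_iff)
  qed
  then have pos: "T \<in> young mu \<rightarrow>\<^sub>E {1..} \<longleftrightarrow> entries T \<subseteq> {..<m} \<times> {1..}"
    by (auto simp: entries_def)
  have "card (entries T `` {j}) = row j" if "j < m" for j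
    using card_image[OF strict_mono_on_imp_inj_on[OF str[OF that]]] by (simp add: entries_row[OF that])
  moreover have "(\<forall>j l. Suc j < m \<and> l < row (Suc j) \<longrightarrow> T (cell j l) \<le> T (cell (Suc j) l))
      \<longleftrightarrow> (\<forall>j t. Suc j < m \<longrightarrow> rank (entries T) t (Suc j) \<le> rank (entries T) t j)"
  proof -
    have "(\<forall>l. l < row (Suc j) \<longrightarrow> T (cell j l) \<le> T (cell (Suc j) l))
      \<longleftrightarrow> (\<forall>t. rank (entries T) t (Suc j) \<le> rank (entries T) t j)" if "Suc j < m" for j
      using interlace_iff[of j "Suc j" 0 T "entries T"] that str row_antimono[of j] by (simp add: entries_row)
    then show ?thesis by blast
  qed
  moreover have "(\<forall>l. l + w < row 0 \<longrightarrow> T (cell (m - 1) l) \<le> T (cell 0 (l + w)))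
      \<longleftrightarrow> (\<forall>t. rank (entries T) t 0 \<le> rank (entries T) t (m - 1) + w)"
    using interlace_iff[of "m - 1" 0 w T "entries T"] m str row_wrap by (simp add: entries_row)
  ultimately show ?thesis
    unfolding CSSYT_iff row_relations_def interlacing_def using pos str finite_entries by auto
qed

lemma bij_entries: "bij_betw entries (CSSYT mu w m) row_relations"
  unfolding bij_betw_def
proof
  have T: "T \<in> young mu \<rightarrow>\<^sub>E UNIV" "\<And>j. j < m \<Longrightarrow> strict_mono_on {..<row j} (\<lambda>l. T (cell j l))"
    if "T \<in> CSSYT mu w m" for T using that unfolding CSSYT_iff by auto
  show "inj_on entries (CSSYT mu w m)"
  proof (rule inj_onI)
    fix T T' assume TT': "T \<in> CSSYT mu w m" "T' \<in> CSSYT mu w m" and eq: "entries T = entries T'"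
    have "T (i, c) = T' (i, c)" if c: "(i, c) \<in> young mu" for i c
    proof -
      obtain j l where jl: "j < m" "l < row j" "(i, c) = cell j l" using cell_cases[OF c] by metis
      have "T (cell j l) \<le> t \<longleftrightarrow> T' (cell j l) \<le> t" for t
        using le_iff_rank_less[OF T(2)[OF TT'(1) jl(1)] jl(2)]
          le_iff_rank_less[OF T(2)[OF TT'(2) jl(1)] jl(2)] eq entries_row[OF jl(1)] by metis
      then show ?thesis using jl(3) by (metis order_antisym order_refl)
    qed
    then show "T = T'" using T(1)[OF TT'(1)] T(1)[OF TT'(2)] by (intro PiE_ext) auto
  qed
  show "entries ` CSSYT mu w m = row_relations"
  proof (intro equalityI subsetI)
    fix R assume "R \<in> entries ` CSSYT mu w m"
    then obtain U where U: "U \<in> CSSYT mu w m" "R = entries U" by blast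
    then show "R \<in> row_relations" using CSSYT_iff_relation[OF T[OF U(1)]] by simp
  next
    fix R assume R: "R \<in> row_relations"
    let ?s = "\<lambda>j. sorted_list_of_set (R `` {j})"
    define pos where "pos = inv_into ({..<m} \<times> UNIV) (\<lambda>(j, l). cell j l)"
    have "inj_on (\<lambda>(j, l). cell j l) ({..<m} \<times> UNIV)" using cell_inj by (auto simp: inj_on_def)
    then have pos: "pos (cell j l) = (j, l)" if "j < m" for j l
      using inv_into_f_f[of "\<lambda>(j, l). cell j l" "{..<m} \<times> UNIV" "(j, l)"] that by (simp add: pos_def)
    \<comment> \<open>Row \<open>j\<close> of the tableau lists the entries related to \<open>j\<close> in increasing order.\<close>
    define T where "T = (\<lambda>c\<in>young mu. case pos c of (j, l) \<Rightarrow> ?s j ! l)"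
    have Tc: "T (cell j l) = ?s j ! l" if "j < m" "l < row j" for j l
      using that by (simp add: T_def pos cell_mem_iff)
    have fin: "finite (R `` {j})" for j using R by (auto simp: row_relations_def)
    have len: "length (?s j) = row j" if "j < m" for j using R that by (simp add: row_relations_def)
    have "strict_mono_on {..<row j} (\<lambda>l. T (cell j l))" if "j < m" for j
    proof (rule strict_mono_onI)
      fix r s assume "r \<in> {..<row j}" "s \<in> {..<row j}" "r < s"
      then show "T (cell j r) < T (cell j s)"
        using sorted_wrt_nth_less[OF strict_sorted_list_of_set[of "R `` {j}"]] len that by (simp add: Tc)
    qed
    moreover have "T \<in> young mu \<rightarrow>\<^sub>E UNIV" by (simp add: T_def)
    moreover have "entries T = R"
    proof -
      have "entries T `` {j} = R `` {j}" for j
      proof (cases "j < m")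
        case True
        have "entries T `` {j} = (\<lambda>l. ?s j ! l) ` {..<row j}"
          unfolding entries_row[OF True] using Tc[OF True] by auto
        also have "\<dots> = set (?s j)" using len[OF True] by (auto simp: set_conv_nth)
        finally show ?thesis using fin by simp
      next
        case False
        then show ?thesis using R by (auto simp: entries_def row_relations_def)
      qed
      then show ?thesis by (auto simp: Image_singleton set_eq_iff)
    qed
    ultimately show "R \<in> entries ` CSSYT mu w m" using CSSYT_iff_relation[of T] R by (metis image_eqI)
  qed
qed

lemma tab_weight_entries:
  assumes "T \<in> CSSYT mu w m"
  shows "tab_weight (young mu) T = (\<Prod>(j, i)\<in>entries T. var i)"
proof -
  have "tab_weight (young mu) T = (\<Prod>i\<in>T ` young mu. \<Prod>c\<in>{c \<in> young mu. T c = i}. var (T c))"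
    unfolding tab_weight_def by (intro prod.cong refl) simp
  also have "\<dots> = (\<Prod>c\<in>young mu. var (T c))"
    by (rule prod.group) (auto simp: finite_young)
  also have "\<dots> = (\<Prod>(j, l)\<in>(SIGMA j:{..<m}. {..<row j}). var (T (cell j l)))"
  proof -
    let ?h = "\<lambda>(j, l). cell j l"
    have "bij_betw ?h (SIGMA j:{..<m}. {..<row j}) (young mu)"
      unfolding bij_betw_def
    proof
      show "inj_on ?h (SIGMA j:{..<m}. {..<row j})"
        using cell_inj by (auto simp: inj_on_def)
      show "?h ` (SIGMA j:{..<m}. {..<row j}) = young mu"
      proof (intro equalityI subsetI)
        fix c assume c: "c \<in> young mu"
        obtain i c' where "c = (i, c')" by fastforce
        then obtain j l where "j < m" "l < row j" "c = cell j l" using cell_cases[of i c'] c by metis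
        then show "c \<in> ?h ` (SIGMA j:{..<m}. {..<row j})" by force
      qed (auto simp: cell_mem_iff)
    qed
    from prod.reindex_bij_betw[OF this, of "\<lambda>c. var (T c)"] show ?thesis
      by (simp add: case_prod_unfold)
  qed
  also have "\<dots> = (\<Prod>(j, i)\<in>entries T. var i)"
  proof (rule prod.reindex_cong[symmetric])
    have "inj_on (\<lambda>l. T (cell j l)) {..<row j}" if "j < m" for j
      using assms that strict_mono_on_imp_inj_on unfolding CSSYT_iff by blast
    then show "inj_on (\<lambda>(j, l). (j, T (cell j l))) (SIGMA j:{..<m}. {..<row j})"
      by (auto simp: inj_on_def)
    show "entries T = (\<lambda>(j, l). (j, T (cell j l))) ` (SIGMA j:{..<m}. {..<row j})"
      by (auto simp: entries_def)
  qed auto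
  finally show ?thesis .
qed

lemma coef_cyl_schur_transpose:
  "coef (cyl_schur_transpose lam m w) M = int (card {R \<in> row_relations. image_mset snd (mset_set R) = M})"
proof -
  let ?C = "{T \<in> CSSYT mu w m. image_mset snd (mset_set (entries T)) = M}"
  have weight: "coef (tab_weight (young mu) T) M = (if image_mset snd (mset_set (entries T)) = M then 1 else 0)"
    if "T \<in> CSSYT mu w m" for T
  proof -
    have "tab_weight (young mu) T = (\<Prod>i\<in>#image_mset snd (mset_set (entries T)). var i)"
      unfolding tab_weight_entries[OF that]
      by (simp add: prod_unfold_prod_mset multiset.map_comp comp_def case_prod_unfold)
    then show ?thesis by (auto simp: coef_monomial)
  qed
  have "coef (cyl_schur_transpose lam m w) M = (\<Sum>T\<in>?C. 1)"
    unfolding cyl_schur_transpose_def cyl_schur_def coef_mfps_sum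
  proof (rule sum.cong)
    show "{T. T \<in> CSSYT mu w m \<and> coef (tab_weight (young mu) T) M \<noteq> 0} = ?C"
      using weight by (metis (mono_tags, lifting) zero_neq_one)
  qed (simp add: weight)
  also have "\<dots> = int (card ?C)" by simp
  also have "card ?C = card {R \<in> row_relations. image_mset snd (mset_set R) = M}"
    by (rule bij_betw_same_card[of entries], rule bij_betw_Collect[OF bij_entries]) simp
  finally show ?thesis .
qed

end


section \<open>The bounded Littlewood identities\<close>

lemma path_sum_cong:
  assumes "alcove N ps" "\<And>l. alcove N l \<Longrightarrow> length l = length ps \<Longrightarrow> c l = c' l"
  shows "path_sum N c k d ps = path_sum N c' k d ps"
proof (cases d)
  case 0
  then show ?thesis using assms by (simp add: path_sum_0)
next
  case (Suc d')
  then have "k + d \<in> {k<..k + d}" by simp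
  then show ?thesis
    unfolding path_sum_def by (intro sum.cong refl) (auto simp: moved_def intro!: arg_cong2[of _ _ _ _ "(*)"] assms(2))
qed

abbreviation start :: "nat \<Rightarrow> int list" where "start m \<equiv> map int (rev [0..<m])"

lemma nth_moved_start:
  "j < m \<Longrightarrow> moved (start m) R t ! j = int (m - Suc j) + int (rank R t j)"
  by (simp add: moved_def rank_def rev_nth)

lemma length_moved [simp]: "length (moved ps R t) = length ps"
  by (simp add: moved_def)

text \<open>
  The starting positions differ by one from particle to particle, and by \<open>m - 1 = N - w - 1\<close> in total,
  so strict inequalities between positions are weak inequalities between distances.
\<close>

lemma alcove_moved_start:
  assumes "m > 0"
  shows "alcove (m + w) (moved (start m) R t) \<longleftrightarrow> interlacing m w R t"
proof -
  let ?ps = "moved (start m) R t"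
  have "sorted_wrt (>) ?ps \<longleftrightarrow> (\<forall>j. Suc j < m \<longrightarrow> rank R t (Suc j) \<le> rank R t j)"
  proof -
    have "?ps ! j > ?ps ! Suc j \<longleftrightarrow> rank R t (Suc j) \<le> rank R t j" if "Suc j < m" for j
      using that by (simp add: nth_moved_start of_nat_diff) linarith
    then show ?thesis by (auto simp: sorted_wrt_iff_nth_Suc_transp[OF transp_on_greater])
  qed
  moreover have "hd ?ps < last ?ps + int (m + w) \<longleftrightarrow> rank R t 0 \<le> rank R t (m - 1) + w"
  proof -
    have "?ps \<noteq> []" using assms by (simp add: moved_def)
    then show ?thesis using assms
      by (simp add: hd_conv_nth last_conv_nth nth_moved_start of_nat_diff) linarith
  qed
  ultimately show ?thesis by (simp add: alcove_def interlacing_def)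
qed

lemma interlacing_0:
  assumes "R \<subseteq> X \<times> {1..}"
  shows "interlacing m w R 0"
proof -
  have "{i. (j, i) \<in> R \<and> i \<le> 0} = {}" for j using assms by auto
  then have "rank R 0 j = 0" for j unfolding rank_def by (metis card.empty)
  then show ?thesis by (simp add: interlacing_def)
qed

lemma interlacing_all_iff:
  assumes R: "R \<subseteq> X \<times> {0<..n}"
  shows "(\<forall>t. interlacing m w R t) \<longleftrightarrow> (\<forall>t\<in>{0<..n}. interlacing m w R t)"
proof
  assume *: "\<forall>t\<in>{0<..n}. interlacing m w R t"
  have 0: "interlacing m w R 0" by (rule interlacing_0[of R X]) (use R in auto)
  show "\<forall>t. interlacing m w R t"
  proof
    fix t
    have "rank R t j = rank R (min t n) j" for j
      unfolding rank_def using R by (intro arg_cong[of _ _ card]) auto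
    then have "interlacing m w R t \<longleftrightarrow> interlacing m w R (min t n)" by (simp add: interlacing_def)
    then show "interlacing m w R t" using * 0 by (cases "min t n = 0") auto
  qed
qed simp

lemma partition_eqI:
  assumes "lam \<in> Par m w" "nu \<in> Par m w" "\<And>j. j < m \<Longrightarrow> part lam (Suc j) = part nu (Suc j)"
  shows "lam = nu"
proof -
  have "part lam i = part nu i" for i
  proof (cases "1 \<le> i \<and> i \<le> m")
    case True
    then obtain j where "i = Suc j" "j < m" by (cases i) auto
    then show ?thesis using assms(3) by simp
  next
    case False
    then show ?thesis using assms(1,2) by (auto simp: Par_def part_def)
  qed
  then have "young lam = young nu" by (simp add: young_def)
  then show ?thesis using assms(1,2) young_inj by (simp add: Par_def)
qed

lemma partition_of_rows:
  assumes m: "m > 0" and anti: "\<And>j. Suc j < m \<Longrightarrow> a (Suc j) \<le> a j" and wrap: "a 0 \<le> a (m - 1) + w"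
  shows "\<exists>lam\<in>Par m w. \<forall>j<m. part lam (Suc j) = a j"
proof -
  have anti': "a j \<le> a i" if "i \<le> j" "j < m" for i j
    using that
  proof (induction j)
    case (Suc j)
    then show ?case using anti[of j] by (cases "i = Suc j") auto
  qed simp
  define S where "S = {(i, c). 1 \<le> i \<and> i \<le> int m \<and> 1 \<le> c \<and> c \<le> int (a (nat (i - 1)))}"
  have "\<exists>lam. is_partition lam \<and> young lam = S"
  proof (rule down_closed_young)
    have "S \<subseteq> {1..int m} \<times> {1..int (a 0)}"
    proof clarify
      fix i c assume ic: "(i, c) \<in> S"
      then have "nat (i - 1) < m" by (auto simp: S_def)
      then show "i \<in> {1..int m} \<and> c \<in> {1..int (a 0)}" using anti'[of 0 "nat (i - 1)"] ic by (auto simp: S_def)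
    qed
    then show "finite S" by (rule finite_subset) simp
    show "1 \<le> i \<and> 1 \<le> j" if "(i, j) \<in> S" for i j using that by (simp add: S_def)
    show "(i', j') \<in> S" if "(i, j) \<in> S" "1 \<le> i'" "i' \<le> i" "1 \<le> j'" "j' \<le> j" for i j i' j'
    proof -
      have "nat (i - 1) < m" "nat (i' - 1) \<le> nat (i - 1)" using that by (auto simp: S_def)
      then have "int (a (nat (i - 1))) \<le> int (a (nat (i' - 1)))" using anti' by simp
      then show ?thesis using that unfolding S_def by auto
    qed
  qed
  then obtain lam where lam: "is_partition lam" "young lam = S" by auto
  have part: "part lam (Suc j) = (if j < m then a j else 0)" for j
  proof -
    have "{c. (int (Suc j), c) \<in> S} = (if j < m then {1..int (a j)} else {})" by (auto simp: S_def)
    then show ?thesis using young_row_card[of "Suc j" lam] lam(2) by auto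
  qed
  have "length lam \<le> m"
  proof (cases "length lam")
    case (Suc k)
    then show ?thesis
      using part_pos_iff[OF lam(1), of "length lam"] part[of k] by (auto split: if_splits)
  qed simp
  then have "lam \<in> Par m w" using lam(1) part[of 0] part[of "m - 1"] wrap m by (simp add: Par_def)
  then show ?thesis using part by (intro bexI[of _ lam]) simp_all
qed

lemma tiling_weight_c_coeff:
  assumes h: "h \<ge> 1" and len: "length ps = 2 * h"
    and ps: "\<And>j. j < 2 * h \<Longrightarrow> ps ! j = int (2 * h - Suc j) + int (part lam (Suc j))"
  shows "tiling_weight e (2 * h + w) ps = c_coeff e h w lam"
proof -
  have gap: "ps ! j = ps ! Suc j + 1 \<longleftrightarrow> part lam (Suc j) = part lam (Suc (Suc j))" if "Suc j < 2 * h" for j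
    using that by (simp add: ps of_nat_diff)
  have "tiled ps \<longleftrightarrow> (\<forall>i<h. part lam (Suc (2 * i)) = part lam (Suc (Suc (2 * i))))"
    unfolding tiled_iff[OF len] using gap[of "2 * i" for i] by auto
  also have "\<dots> \<longleftrightarrow> (\<forall>i. 1 \<le> i \<and> i \<le> h \<longrightarrow> part lam (2 * i - 1) = part lam (2 * i))"
  proof (intro iffI allI impI)
    fix i assume "\<forall>i<h. part lam (Suc (2 * i)) = part lam (Suc (Suc (2 * i)))" "1 \<le> i \<and> i \<le> h"
    then show "part lam (2 * i - 1) = part lam (2 * i)" by (cases i) auto
  next
    fix i assume *: "\<forall>i. 1 \<le> i \<and> i \<le> h \<longrightarrow> part lam (2 * i - 1) = part lam (2 * i)" and "i < h"
    then show "part lam (Suc (2 * i)) = part lam (Suc (Suc (2 * i)))" using *[rule_format, of "Suc i"] by simp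
  qed
  finally have aligned: "tiled ps \<longleftrightarrow> (\<forall>i. 1 \<le> i \<and> i \<le> h \<longrightarrow> part lam (2 * i - 1) = part lam (2 * i))" .
  have inner: "length (butlast (tl ps)) = 2 * (h - 1)"
    "j < 2 * (h - 1) \<Longrightarrow> butlast (tl ps) ! j = ps ! Suc j" for j
    using len by (auto simp: nth_butlast nth_tl)
  have "tiled (butlast (tl ps)) \<longleftrightarrow> (\<forall>i<h - 1. part lam (Suc (Suc (2 * i))) = part lam (Suc (Suc (Suc (2 * i)))))"
    unfolding tiled_iff[OF inner(1)] using gap[of "Suc (2 * i)" for i] inner(2) by auto
  also have "\<dots> \<longleftrightarrow> (\<forall>i. 1 \<le> i \<and> i \<le> h - 1 \<longrightarrow> part lam (2 * i) = part lam (2 * i + 1))"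
  proof (intro iffI allI impI)
    fix i assume "\<forall>i<h - 1. part lam (Suc (Suc (2 * i))) = part lam (Suc (Suc (Suc (2 * i))))" "1 \<le> i \<and> i \<le> h - 1"
    then show "part lam (2 * i) = part lam (2 * i + 1)" by (cases i) auto
  next
    fix i assume *: "\<forall>i. 1 \<le> i \<and> i \<le> h - 1 \<longrightarrow> part lam (2 * i) = part lam (2 * i + 1)" and "i < h - 1"
    then show "part lam (Suc (Suc (2 * i))) = part lam (Suc (Suc (Suc (2 * i))))" using *[rule_format, of "Suc i"] by simp
  qed
  finally have shifted: "tiled (butlast (tl ps)) \<longleftrightarrow>
      (\<forall>i. 1 \<le> i \<and> i \<le> h - 1 \<longrightarrow> part lam (2 * i) = part lam (2 * i + 1))" .
  have "ps \<noteq> []" using len h by auto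
  then have wrap: "hd ps - last ps = int (2 * h + w) - 1 \<longleftrightarrow> int (part lam 1) - int (part lam (2 * h)) = int w"
    using h len by (simp add: hd_conv_nth last_conv_nth ps of_nat_diff)
  show ?thesis unfolding tiling_weight_def c_coeff_def aligned shifted wrap by (rule refl)
qed

text \<open>
  A motion determines the shape \<open>\<lambda>\<close> as the list of the total distances, so the sum over the shapes of
  the tableaux is a sum over all collision-free motions.  The condition on \<open>M\<close> confines the motion to the
  times \<open>1, \<dots>, n\<close>.
\<close>

lemma coef_cylindric_sum:
  assumes h: "h \<ge> 1" and w: "w \<ge> 1" and M: "set_mset M \<subseteq> {..n}"
  shows "coef (mfps_sum (\<lambda>lam. of_int (c_coeff e h w lam) * cyl_schur_transpose lam (2 * h) w) (Par (2 * h) w)) M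
    = coef (path_sum (2 * h + w) (\<lambda>ps. of_int (tiling_weight e (2 * h + w) ps)) 0 n (start (2 * h))) M"
proof -
  define m where "m = 2 * h"
  have m: "m > 0" using h by (simp add: m_def)
  let ?P = "Pow ({..<m} \<times> {0<..n})"
  let ?content = "\<lambda>R :: (nat \<times> nat) set. image_mset snd (mset_set R)"
  define Q where "Q = {R \<in> ?P. (\<forall>t. interlacing m w R t) \<and> ?content R = M}"
  have finP: "finite ?P" by simp
  have finQ: "finite Q" unfolding Q_def by (rule finite_subset[OF _ finP]) auto
  have rank_n: "rank R n j = card (R `` {j})" if "R \<in> ?P" for R j
    unfolding rank_def using that by (intro arg_cong[of _ _ card]) auto
  define shape where "shape R = (THE lam. lam \<in> Par m w \<and> (\<forall>j<m. part lam (Suc j) = card (R `` {j})))" for R :: "(nat \<times> nat) set"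
  have shape: "shape R \<in> Par m w \<and> (\<forall>j<m. part (shape R) (Suc j) = card (R `` {j}))" if "R \<in> Q" for R
    unfolding shape_def
  proof (rule theI', rule ex_ex1I)
    have "interlacing m w R n" "R \<in> ?P" using that by (auto simp: Q_def)
    then have "\<exists>lam\<in>Par m w. \<forall>j<m. part lam (Suc j) = card (R `` {j})"
      using rank_n[of R] by (intro partition_of_rows m) (simp_all add: interlacing_def)
    then show "\<exists>lam. lam \<in> Par m w \<and> (\<forall>j<m. part lam (Suc j) = card (R `` {j}))" by blast
  qed (use partition_eqI in metis)
  have fibre: "{R \<in> cylindric.row_relations lam m w. ?content R = M} = {R \<in> Q. shape R = lam}"
    if lam: "lam \<in> Par m w" for lam
  proof -
    interpret cylindric lam m w by unfold_locales (use lam m w in auto)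
    show ?thesis
    proof (intro equalityI subsetI)
      fix R assume R: "R \<in> {R \<in> row_relations. ?content R = M}"
      have "i \<le> n" if "(j, i) \<in> R" for i j
      proof -
        have "i \<in># M" using R that by (force simp: row_relations_def)
        then show ?thesis using M by auto
      qed
      then have "R \<in> ?P" using R by (fastforce simp: row_relations_def)
      then have RQ: "R \<in> Q" using R unfolding Q_def row_relations_def by blast
      have "shape R = lam"
        by (rule partition_eqI[of _ m w]) (use shape[OF RQ] lam R in \<open>auto simp: row_relations_def row_def\<close>)
      then show "R \<in> {R \<in> Q. shape R = lam}" using RQ by simp
    next
      fix R assume R: "R \<in> {R \<in> Q. shape R = lam}"
      then have "R \<subseteq> {..<m} \<times> {0<..n}" by (simp add: Q_def)
      then have "R \<subseteq> {..<m} \<times> {1..}" by auto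
      moreover have "finite R" by (rule finite_subset[OF \<open>R \<subseteq> {..<m} \<times> {0<..n}\<close>]) simp
      moreover have "\<forall>j<m. card (R `` {j}) = row j" using shape[of R] R by (simp add: row_def)
      moreover have "(\<forall>t. interlacing m w R t)" "?content R = M" using R by (simp_all add: Q_def)
      ultimately show "R \<in> {R \<in> row_relations. ?content R = M}"
        unfolding row_relations_def by blast
    qed
  qed
  have "coef (of_int (c_coeff e h w lam) * cyl_schur_transpose lam m w) M
      = (\<Sum>R\<in>Q. if shape R = lam then c_coeff e h w (shape R) else 0)" if lam: "lam \<in> Par m w" for lam
  proof -
    have "cylindric lam m w" by unfold_locales (use lam m w in auto)
    from cylindric.coef_cyl_schur_transpose[OF this, of M]
    have "coef (cyl_schur_transpose lam m w) M = int (card {R \<in> Q. shape R = lam})"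
      by (simp only: fibre[OF lam])
    then have "coef (of_int (c_coeff e h w lam) * cyl_schur_transpose lam m w) M
        = (\<Sum>R\<in>{R \<in> Q. shape R = lam}. c_coeff e h w lam)"
      by (simp add: coef_of_int_times)
    also have "\<dots> = (\<Sum>R\<in>Q. if shape R = lam then c_coeff e h w lam else 0)"
      using finQ by (rule sum.inter_filter)
    also have "\<dots> = (\<Sum>R\<in>Q. if shape R = lam then c_coeff e h w (shape R) else 0)"
      by (intro sum.cong) auto
    finally show ?thesis .
  qed
  then have "coef (mfps_sum (\<lambda>lam. of_int (c_coeff e h w lam) * cyl_schur_transpose lam m w) (Par m w)) M
      = (\<Sum>R\<in>{R \<in> Q. shape R \<in> Par m w}. c_coeff e h w (shape R))"
    unfolding coef_mfps_sum by (intro sum_over_fibres finQ)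
  also have "{R \<in> Q. shape R \<in> Par m w} = Q" using shape by auto
  also have "(\<Sum>R\<in>Q. c_coeff e h w (shape R))
      = (\<Sum>R\<in>Q. tiling_weight e (m + w) (moved (start m) R n))"
  proof (intro sum.cong refl)
    fix R assume R: "R \<in> Q"
    then have "R \<in> ?P" by (simp add: Q_def)
    then show "c_coeff e h w (shape R) = tiling_weight e (m + w) (moved (start m) R n)"
      unfolding m_def using shape[OF R] rank_n[of R]
      by (intro tiling_weight_c_coeff[symmetric] h) (simp_all add: nth_moved_start m_def)
  qed
  also have "\<dots> = (\<Sum>R\<in>?P. coef (if \<forall>t\<in>{0<..n}. alcove (m + w) (moved (start m) R t)
     then of_int (tiling_weight e (m + w) (moved (start m) R n)) * (\<Prod>(j, i)\<in>R. var i) else 0) M)"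
  proof (rule sum.mono_neutral_cong_left[OF finP])
    have summand: "coef (if \<forall>t\<in>{0<..n}. alcove (m + w) (moved (start m) R t)
         then of_int (tiling_weight e (m + w) (moved (start m) R n)) * (\<Prod>(j, i)\<in>R. var i) else 0) M
       = (if R \<in> Q then tiling_weight e (m + w) (moved (start m) R n) else 0)" if R: "R \<in> ?P" for R
    proof -
      have "(\<Prod>(j, i)\<in>R. var i) = (\<Prod>i\<in>#?content R. var i)"
        by (simp add: prod_unfold_prod_mset multiset.map_comp comp_def case_prod_unfold)
      then have "coef (\<Prod>(j, i)\<in>R. var i) M = (if M = ?content R then 1 else 0)" by (simp only: coef_monomial)
      then show ?thesis
        using R interlacing_all_iff[of R "{..<m}" n m w]
        by (auto simp: Q_def alcove_moved_start[OF m] coef_of_int_times)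
    qed
    show "\<forall>R\<in>?P - Q. coef (if \<forall>t\<in>{0<..n}. alcove (m + w) (moved (start m) R t)
         then of_int (tiling_weight e (m + w) (moved (start m) R n)) * (\<Prod>(j, i)\<in>R. var i) else 0) M = 0"
      using summand by simp
    show "tiling_weight e (m + w) (moved (start m) R n) = coef (if \<forall>t\<in>{0<..n}. alcove (m + w) (moved (start m) R t)
         then of_int (tiling_weight e (m + w) (moved (start m) R n)) * (\<Prod>(j, i)\<in>R. var i) else 0) M"
      if "R \<in> Q" for R
      using summand[of R] that by (simp add: Q_def)
  qed (auto simp: Q_def)
  also have "\<dots> = coef (path_sum (m + w) (\<lambda>ps. of_int (tiling_weight e (m + w) ps)) 0 n (start m)) M"
    by (simp add: path_sum_def coef_sum cong: if_cong)
  finally show ?thesis by (simp add: m_def)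
qed

lemma restrict_det_signed_F:
  assumes h: "h \<ge> 1" and w: "w \<ge> 1" and s: "s * s = 1"
  shows "restrict_vars {..n} (det (mat h h (\<lambda>(i, j).
      signed_F s (int j - int i) (2 * h + w) - signed_F s (int i + int j + 2) (2 * h + w))))
    = path_sum (2 * h + w) (\<lambda>ps. of_int (tiling_weight (- s) (2 * h + w) ps)) 0 n (start (2 * h))"
proof -
  let ?N = "2 * h + w" and ?ks = "[Suc 0..<Suc (0 + n)]"
  let ?G = "signed_F_in s ?N ?ks"
  interpret comm_ring_hom "restrict_vars {..n}" by (rule restrict_vars_hom)
  have N: "?N > 0" using w by simp
  have alcove: "alcove ?N (start (2 * h))"
  proof -
    have "moved (start (2 * h)) {} 0 = start (2 * h)"
      by (rule nth_equalityI) (simp_all add: moved_def)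
    moreover have "interlacing (2 * h) w {} 0" by (simp add: interlacing_def rank_def)
    ultimately show ?thesis
      using alcove_moved_start[of "2 * h" w "{}" 0] h by simp
  qed
  have restrict: "restrict_vars {..n} (signed_F s r ?N) = ?G r" for r
    using restrict_signed_F[OF N, of n s r] by simp
  have "restrict_vars {..n} (det (mat h h (\<lambda>(i, j). signed_F s (int j - int i) ?N - signed_F s (int i + int j + 2) ?N)))
      = det (mat h h (\<lambda>(i, j). ?G (int j - int i) - ?G (int i + int j + 2)))"
    unfolding hom_det[symmetric]
    by (intro arg_cong[of _ _ det] eq_matI) (auto simp: hom_minus restrict simp del: upt_Suc)
  also have "\<dots> = det (mat h h (\<lambda>(i, j). ?G (int i - int j) - ?G (int i + int j + 2)))"
    using signed_F_in_minus[of s ?N ?ks "int j - int i" for i j] by simp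
  also have "\<dots> = pfaff (\<lambda>a b. ?G (a - b - 1) - ?G (a - b + 1)) h (start (2 * h))"
    by (rule pfaff_toeplitz[symmetric]) (rule signed_F_in_minus)
  also have "\<dots> = pfaff (dimer s ?N ?ks) h (start (2 * h))"
    by (simp only: dimer_def[abs_def])
  also have "\<dots> = path_sum ?N (pfaff (dimer s ?N []) h) 0 n (start (2 * h))"
    by (rule path_sum_pfaff[OF N s alcove, symmetric]) (use h in simp)
  also have "\<dots> = path_sum ?N (\<lambda>ps. of_int (tiling_weight (- s) ?N ps)) 0 n (start (2 * h))"
    by (rule path_sum_cong[OF alcove], rule pfaff_initial) (use h w in auto)
  finally show ?thesis .
qed

text \<open>
  The sign is reversed because the kernel has the value \<open>- s\<close> on a dimer that crosses the cut.
\<close>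

lemma cylindric_sum_eq_det:
  assumes h: "h \<ge> 1" and w: "w \<ge> 1" and s: "s * s = 1"
  shows "mfps_sum (\<lambda>lam. of_int (c_coeff (- s) h w lam) * cyl_schur_transpose lam (2 * h) w) (Par (2 * h) w)
    = det (mat h h (\<lambda>(i, j). signed_F s (int j - int i) (2 * h + w) - signed_F s (int i + int j + 2) (2 * h + w)))"
    (is "?sum = ?det")
proof (rule mfps_eqI)
  fix M :: "nat multiset"
  define n where "n = Max (insert 0 (set_mset M))"
  have M: "set_mset M \<subseteq> {..n}" by (auto simp: n_def)
  have "coef ?sum M = coef (restrict_vars {..n} ?det) M"
    by (simp only: coef_cylindric_sum[OF h w M] restrict_det_signed_F[OF h w s])
  then show "coef ?sum M = coef ?det M" using M by (simp add: coef_restrict_vars)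
qed

theorem theorem3p3:
  fixes h w :: nat
  assumes "h \<ge> 1" and "w \<ge> 1"
  shows "mfps_sum (\<lambda>lam. of_int (c_coeff 1 h w lam) * cyl_schur_transpose lam (2 * h) w) (Par (2 * h) w)
      = det (mat h h (\<lambda>(i, j).
          let i' = int i + 1; j' = int j + 1
          in Fbar_series (- i' + j') (2 * h + w) - Fbar_series (i' + j') (2 * h + w)))
    \<and> mfps_sum (\<lambda>lam. of_int (c_coeff (- 1) h w lam) * cyl_schur_transpose lam (2 * h) w) (Par (2 * h) w)
      = det (mat h h (\<lambda>(i, j).
          let i' = int i + 1; j' = int j + 1
          in F_series (- i' + j') (2 * h + w) - F_series (i' + j') (2 * h + w)))"
proof -
  have "- (int i + 1) + (int j + 1) = int j - int i" "int i + 1 + (int j + 1) = int i + int j + 2" for i j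
    by simp_all
  then show ?thesis
    using cylindric_sum_eq_det[OF assms, of "- 1"] cylindric_sum_eq_det[OF assms, of 1]
    by (simp only: Let_def F_series_signed_F Fbar_series_signed_F) simp
qed

end
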